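(* For each integer $n\geq 1$ and each prime power $q$, let $C_n(q)$ be the number of ideals $J$ of codimension $n$ (i.e. with $\dim_{\mathbb{F}_q} \mathbb{F}_q[x,y,x^{-1},y^{-1}]/J = n$) of the Laurent polynomial algebra $\mathbb{F}_q[x,y,x^{-1},y^{-1}]$. Then for each $n \geq 1$ $$C_n(q) = \sum_{\lambda \,\vdash n} (q-1)^{2 v(\lambda)} \, q^{n - \ell(\lambda)} \prod_{1\leq i\leq t,\; d_i \geq 1} \frac{q^{2d_i} - 1}{q^2 - 1},$$ where the sum runs over all partitions $\lambda$ of $n$, and $t$, $d_1,\ldots,d_t$, $v(\lambda)$, $\ell(\lambda)$ are attached to $\lambda$ as in the context. The expression $C_n(q)$ is a monic polynomial of degree $2n$ in the variable $q$ with integer coefficients. Moreover, the polynomial $C_n(q)$ is divisible by $(q-1)^2$.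
   Context: $\mathbb{F}_q$ is a finite field of cardinality $q$. For a partition $\lambda$ of $n\ge 1$, let $\ell(\lambda)$ be its length (number of parts), and let $t$ be the number of columns of its Ferrers diagram (i.e. the largest part of $\lambda$; the rows of the diagram are the parts). Counting the boxes of the columns of the Ferrers diagram from right to left gives a sequence $0 = m_0 < m_1 \leq \cdots \leq m_t$ with $m_1+\cdots+m_t=n$; explicitly, for $1\le i\le t$, $m_i$ is the number of parts of $\lambda$ that are $\geq t-i+1$ (so $m_t=\ell(\lambda)$). Set $d_i = m_i - m_{i-1}\geq 0$ for $1\le i\le t$, and $v(\lambda) = \mathrm{card}\{i\in\{1,\ldots,t\} : d_i \geq 1\}$, which is the number of distinct values in the sequence $m_1\le\cdots\le m_t$. *)

theory Defs
  imports
    "HOL-Algebra.Algebraic_Closure_Type"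
    "HOL-Algebra.Embedded_Algebras"
    "HOL-Algebra.QuotRing"
    "HOL-Library.Poly_Mapping"
    "HOL-Library.Product_Plus"
    "HOL-Library.Multiset"
    "HOL-Library.Cardinality"
    "HOL-Number_Theory.Prime_Powers"
begin

text \<open>
  The Laurent polynomial algebra in two variables: a finitely supported map
  \<open>int \<times> int \<Rightarrow> 'a\<close> sends \<open>(a, b)\<close> to the coefficient of \<open>x\<^sup>a y\<^sup>b\<close>. The multiplication of
  \<^type>\<open>poly_mapping\<close> is the convolution with respect to the addition of exponents.
\<close>
type_synonym 'a laurent2 = "(int \<times> int) \<Rightarrow>\<^sub>0 'a"

definition laurent2_ring :: "'a::field laurent2 ring"
  where "laurent2_ring = ring_of_type_algebra"

text \<open>
  The dimension of the quotient is taken over the image of the constant Laurent polynomials,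
  which is a copy of the ground field whenever the ideal is proper. The unit ideal has
  codimension 0 and no other codimension.
\<close>
definition has_codim :: "'a::field laurent2 set \<Rightarrow> nat \<Rightarrow> bool"
  where "has_codim J n \<longleftrightarrow>
    ring.dimension (laurent2_ring Quot J) n
      (range (\<lambda>c. J +>\<^bsub>laurent2_ring\<^esub> Poly_Mapping.single 0 c))
      (carrier (laurent2_ring Quot J))"

text \<open>
  As \<open>card\<close> is 0 on infinite sets, a nonzero value of this count includes finiteness.
\<close>
definition ideal_count :: "'a::{field, finite} itself \<Rightarrow> nat \<Rightarrow> nat"
  where "ideal_count TYPE('a) n =
    card {J :: 'a laurent2 set. ideal J laurent2_ring \<and> has_codim J n}"

definition partitions_of :: "nat \<Rightarrow> nat multiset set"
  where "partitions_of n = {\<mu>. 0 \<notin># \<mu> \<and> sum_mset \<mu> = n}"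

definition num_cols :: "nat multiset \<Rightarrow> nat"
  where "num_cols \<mu> = Max (set_mset \<mu>)"

text \<open>
  \<open>col_len \<mu> i\<close> is \<open>m\<^sub>i\<close>, the length of the \<open>i\<close>-th column from the right, for \<open>1 \<le> i \<le> t\<close>;
  the same formula gives \<open>m\<^sub>0 = 0\<close>. Since the sequence is increasing on \<open>{0..t}\<close>, the
  subtraction in \<open>d\<^sub>i\<close> does not truncate there.
\<close>
definition col_len :: "nat multiset \<Rightarrow> nat \<Rightarrow> nat"
  where "col_len \<mu> i = size {#p \<in># \<mu>. p \<ge> num_cols \<mu> - i + 1#}"

definition col_diff :: "nat multiset \<Rightarrow> nat \<Rightarrow> nat"
  where "col_diff \<mu> i = col_len \<mu> i - col_len \<mu> (i - 1)"

definition jumps :: "nat multiset \<Rightarrow> nat set"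
  where "jumps \<mu> = {i \<in> {1..num_cols \<mu>}. col_diff \<mu> i \<ge> 1}"

definition num_jumps :: "nat multiset \<Rightarrow> nat"
  where "num_jumps \<mu> = card (jumps \<mu>)"

text \<open>The right-hand side of the formula for \<open>C\<^sub>n(q)\<close>.\<close>
definition C_expr :: "nat \<Rightarrow> rat \<Rightarrow> rat"
  where "C_expr n q =
    (\<Sum>\<mu> \<in> partitions_of n.
      (q - 1) ^ (2 * num_jumps \<mu>) * q ^ (n - size \<mu>) *
      (\<Prod>i \<in> jumps \<mu>. (q ^ (2 * col_diff \<mu> i) - 1) / (q ^ 2 - 1)))"

end

theory Submission
  imports Defs "HOL-Computational_Algebra.Computational_Algebra"
begin

text \<open>
  Ideals of finite codimension of \<open>k[x, y, 1/x, 1/y]\<close> correspond to the ideals \<open>J\<close> of finite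
  codimension of \<open>k[x, y]\<close> modulo which \<open>x y\<close> is invertible. Such a \<open>J\<close> contains a polynomial \<open>H\<close> that is
  monic in \<open>y\<close>, say of degree \<open>t + 1\<close>. If \<open>g \<in> k[x]\<close> generates the ideal of leading coefficients of
  the elements of \<open>J\<close> of degree \<open>t\<close> in \<open>y\<close>, then \<open>g\<close> divides all elements of \<open>J\<close> of degree at most \<open>t\<close>,
  so that \<open>J = g J' + (H)\<close> with \<open>J' = (J : g)\<close>, which contains a monic polynomial of degree \<open>t\<close>.
  Conversely \<open>g\<close>, \<open>J'\<close> and \<open>H \<in> J'\<close> determine \<open>J\<close>, and \<open>H\<close> matters only modulo the multiples by \<open>g\<close>
  of the elements of \<open>J'\<close> of degree at most \<open>t\<close>. With \<open>e = deg g\<close>, the codimension grows by \<open>(t + 1) e\<close>;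
  \<open>x\<close> stays invertible iff \<open>g(0) \<noteq> 0\<close>, and \<open>y\<close> iff \<open>H(0)\<close> is a unit modulo \<open>g\<close>. As \<open>H(0)\<close> is
  equidistributed modulo \<open>g\<close>, each pair \<open>(g, J')\<close> yields \<open>q^(t e) \<phi>(g)\<close> ideals. The sum of \<open>\<phi>(g)\<close> over
  the monic \<open>g\<close> of degree \<open>e \<ge> 1\<close> with \<open>g(0) \<noteq> 0\<close> is \<open>(q - 1)\<^sup>2 (q^(2 e) - 1) / (q\<^sup>2 - 1)\<close>, and the degrees
  \<open>e\<close> that occur are the multiplicities of the parts \<open>t + 1\<close> of a partition of \<open>n\<close>.
\<close>


section \<open>Indices of additive subgroups\<close>

definition subgrp :: "'a::ab_group_add set \<Rightarrow> bool"
  where "subgrp B \<longleftrightarrow> 0 \<in> B \<and> (\<forall>a\<in>B. \<forall>b\<in>B. a - b \<in> B)"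

definition rcoset :: "'a::ab_group_add set \<Rightarrow> 'a \<Rightarrow> 'a set"
  where "rcoset B a = {b. b - a \<in> B}"

lemma subgrp_0: "subgrp B \<Longrightarrow> 0 \<in> B"
  and subgrp_diff: "subgrp B \<Longrightarrow> a \<in> B \<Longrightarrow> b \<in> B \<Longrightarrow> a - b \<in> B"
  by (auto simp: subgrp_def)

lemma subgrp_minus: "subgrp B \<Longrightarrow> a \<in> B \<Longrightarrow> - a \<in> B"
  using subgrp_diff[of B 0 a] by (simp add: subgrp_0)

lemma subgrp_add: "subgrp B \<Longrightarrow> a \<in> B \<Longrightarrow> b \<in> B \<Longrightarrow> a + b \<in> B"
  using subgrp_diff[of B a "- b"] by (simp add: subgrp_minus)

lemma subgrp_add_iff: "subgrp B \<Longrightarrow> b \<in> B \<Longrightarrow> a + b \<in> B \<longleftrightarrow> a \<in> B"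
  by (metis add_diff_cancel subgrp_add subgrp_diff)

lemma subgrp_UNIV: "subgrp UNIV"
  and subgrp_Int: "subgrp A \<Longrightarrow> subgrp B \<Longrightarrow> subgrp (A \<inter> B)"
  by (auto simp: subgrp_def)

lemma rcoset_eq_iff:
  assumes "subgrp B"
  shows "rcoset B a = rcoset B b \<longleftrightarrow> a - b \<in> B"
proof
  assume "rcoset B a = rcoset B b"
  moreover have "a \<in> rcoset B a" using assms by (simp add: rcoset_def subgrp_0)
  ultimately show "a - b \<in> B" by (simp add: rcoset_def)
next
  assume ab: "a - b \<in> B"
  have "c - a \<in> B \<longleftrightarrow> c - b \<in> B" for c
    using subgrp_add_iff[OF assms ab, of "c - a"] by simp
  thus "rcoset B a = rcoset B b" by (auto simp: rcoset_def)
qed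

text \<open>The number of cosets of \<open>B\<close> that meet \<open>A\<close>; here
  \<open>A\<close> need not be a subgroup. For nonempty \<open>A\<close> the value 0 stands for an
  infinite index, so \<open>rindex A B > 0\<close> is the way to say that the index is
  finite.\<close>

definition rindex :: "'a::ab_group_add set \<Rightarrow> 'a set \<Rightarrow> nat"
  where "rindex A B = card (rcoset B ` A)"

text \<open>Two maps with the same fibres on \<open>Z\<close> have images in bijection. This also
  covers infinite images, both cardinalities then being 0.\<close>

lemma card_image_eq_of_kernel_eq:
  assumes "\<And>a b. a \<in> Z \<Longrightarrow> b \<in> Z \<Longrightarrow> f a = f b \<longleftrightarrow> g a = g b"
  shows "card (f ` Z) = card (g ` Z)"
proof -
  have "bij_betw (\<lambda>y. g (inv_into Z f y)) (f ` Z) (g ` Z)"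
    unfolding bij_betw_def
  proof
    show "inj_on (\<lambda>y. g (inv_into Z f y)) (f ` Z)"
      by (rule inj_onI) (metis assms f_inv_into_f inv_into_into)
    have "g (inv_into Z f (f x)) = g x" if "x \<in> Z" for x
      using that assms by (metis f_inv_into_f imageI inv_into_into)
    thus "(\<lambda>y. g (inv_into Z f y)) ` f ` Z = g ` Z"
      by (force simp: image_image)
  qed
  thus ?thesis by (rule bij_betw_same_card)
qed

lemma rindex_eq_card_image:
  assumes "subgrp B" "\<And>a b. a \<in> A \<Longrightarrow> b \<in> A \<Longrightarrow> f a = f b \<longleftrightarrow> a - b \<in> B"
  shows "rindex A B = card (f ` A)"
  unfolding rindex_def
  by (rule card_image_eq_of_kernel_eq) (simp add: assms rcoset_eq_iff)

text \<open>Each fibre of \<open>f\<close> is a translate of \<open>B\<close>, hence consists of \<open>rindex B C\<close> cosets of \<open>C\<close>.\<close>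
lemma rindex_vimage:
  assumes A: "subgrp A" and B: "subgrp B" and C: "subgrp C" and CB: "C \<subseteq> B" and BA: "B \<subseteq> A"
    and f: "\<And>a b. a \<in> A \<Longrightarrow> b \<in> A \<Longrightarrow> f a = f b \<longleftrightarrow> a - b \<in> B"
    and T: "T \<subseteq> f ` A"
  shows "rindex {a \<in> A. f a \<in> T} C = card T * rindex B C"
proof -
  define Z where "Z = {a \<in> A. f a \<in> T}"
  define s where "s = inv_into A f"
  have s: "s t \<in> A" "f (s t) = t" if "t \<in> T" for t
    using that T by (auto simp: s_def f_inv_into_f inv_into_into)
  \<comment> \<open>\<open>g a\<close> records the value of \<open>f\<close> and the coset of the
    displacement of \<open>a\<close> from the representative \<open>s (f a)\<close> chosen in its
    fibre. Two elements have the same \<open>g\<close> iff they lie in the same coset of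
    \<open>C\<close>.\<close>
  define g where "g a = (f a, rcoset C (a - s (f a)))" for a
  have "rindex Z C = card (g ` Z)"
    unfolding rindex_def
  proof (rule card_image_eq_of_kernel_eq)
    fix a b assume ab: "a \<in> Z" "b \<in> Z"
    have "f a = f b" if "a - b \<in> C"
      using that f ab CB by (auto simp: Z_def)
    moreover have "rcoset C (a - s (f a)) = rcoset C (b - s (f b)) \<longleftrightarrow> a - b \<in> C" if "f a = f b"
      using that by (simp add: rcoset_eq_iff[OF C])
    ultimately show "rcoset C a = rcoset C b \<longleftrightarrow> g a = g b"
      by (auto simp: g_def rcoset_eq_iff[OF C])
  qed
  also have "g ` Z = T \<times> rcoset C ` B"
  proof
    show "g ` Z \<subseteq> T \<times> rcoset C ` B"
    proof (rule image_subsetI)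
      fix x assume x: "x \<in> Z"
      hence "f x \<in> T" "x \<in> A" by (auto simp: Z_def)
      hence "x - s (f x) \<in> B" using s f by metis
      thus "g x \<in> T \<times> rcoset C ` B" using \<open>f x \<in> T\<close> by (simp add: g_def)
    qed
    show "T \<times> rcoset C ` B \<subseteq> g ` Z"
    proof clarify
      fix t b assume t: "t \<in> T" and b: "b \<in> B"
      have "s t + b \<in> A" using s(1)[OF t] b BA by (auto intro: subgrp_add[OF A])
      moreover have "f (s t + b) = t" using calculation f[of "s t + b" "s t"] s[OF t] b by simp
      ultimately have "s t + b \<in> Z" "g (s t + b) = (t, rcoset C b)"
        using t by (simp_all add: Z_def g_def)
      thus "(t, rcoset C b) \<in> g ` Z" by (metis imageI)
    qed
  qed
  finally show ?thesis by (simp add: Z_def rindex_def card_cartesian_product)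
qed

text \<open>Tower law: the case of \<open>rindex_vimage\<close> where \<open>f\<close> is the coset
  map and \<open>T\<close> its whole image. It remains true with 0 for infinite indices, so a
  nonzero left side makes both factors finite.\<close>

lemma rindex_mult:
  assumes "subgrp A" "subgrp B" "subgrp C" "C \<subseteq> B" "B \<subseteq> A"
  shows "rindex A C = rindex A B * rindex B C"
proof -
  have "{a \<in> A. rcoset B a \<in> rcoset B ` A} = A" by auto
  thus ?thesis
    using rindex_vimage[OF assms, of "rcoset B" "rcoset B ` A"] rcoset_eq_iff[OF assms(2)]
    by (simp add: rindex_def)
qed

lemma rindex_image:
  assumes "subgrp B" "subgrp (h ` B)" "\<And>a b. h (a - b) = h a - h b" "inj h"
  shows "rindex (h ` A) (h ` B) = rindex A B"
proof -
  have "card (rcoset (h ` B) ` h ` A) = card (rcoset B ` A)"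
    unfolding image_image
    by (rule card_image_eq_of_kernel_eq)
      (simp add: rcoset_eq_iff assms(1,2) assms(3)[symmetric] inj_image_mem_iff[OF assms(4)])
  thus ?thesis by (simp add: rindex_def)
qed

section \<open>Ideals of finite index\<close>

definition is_ideal :: "'a::comm_ring_1 set \<Rightarrow> bool"
  where "is_ideal J \<longleftrightarrow> 0 \<in> J \<and> (\<forall>a\<in>J. \<forall>b\<in>J. a + b \<in> J) \<and> (\<forall>a\<in>J. \<forall>r. r * a \<in> J)"

lemma is_ideal_0: "is_ideal J \<Longrightarrow> 0 \<in> J"
  and is_ideal_add: "is_ideal J \<Longrightarrow> a \<in> J \<Longrightarrow> b \<in> J \<Longrightarrow> a + b \<in> J"
  and is_ideal_mult: "is_ideal J \<Longrightarrow> a \<in> J \<Longrightarrow> r * a \<in> J"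
  by (auto simp: is_ideal_def)

lemma is_ideal_diff: "is_ideal J \<Longrightarrow> a \<in> J \<Longrightarrow> b \<in> J \<Longrightarrow> a - b \<in> J"
  using is_ideal_add[of J a "- b"] is_ideal_mult[of J b "- 1"] by simp

lemma is_ideal_subgrp: "is_ideal J \<Longrightarrow> subgrp J"
  by (simp add: subgrp_def is_ideal_0 is_ideal_diff)

abbreviation idx :: "'a::comm_ring_1 set \<Rightarrow> nat"
  where "idx J \<equiv> rindex UNIV J"

text \<open>The infinite case serves for the powers of x in \<open>ideal_nontrivial_of_idx\<close>,
  the finite one for the combinations of powers of y in \<open>monic_of_idx\<close>.\<close>

lemma rindex_pigeonhole:
  assumes B: "subgrp B" and A: "A \<subseteq> D" and fin: "rindex D B > 0" and card: "infinite A \<or> rindex D B < card A"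
  shows "\<exists>a\<in>A. \<exists>b\<in>A. a \<noteq> b \<and> a - b \<in> B"
proof (rule ccontr)
  assume *: "\<not> ?thesis"
  hence inj: "inj_on (rcoset B) A"
    by (auto simp: inj_on_def rcoset_eq_iff[OF B])
  have "finite (rcoset B ` D)" using fin by (simp add: rindex_def card_gt_0_iff)
  moreover have "rcoset B ` A \<subseteq> rcoset B ` D" using A by blast
  ultimately have "finite (rcoset B ` A)" "card (rcoset B ` A) \<le> card (rcoset B ` D)"
    by (auto intro: finite_subset card_mono)
  thus False using inj card by (auto simp: rindex_def finite_image_iff card_image)
qed


section \<open>Truncated polynomials and ideals\<close>

text \<open>A nonzero element of least degree, made monic, divides all others, since the remainders
  lie in the ideal and have smaller degree.\<close>

lemma ideal_poly_principal:
  fixes I :: "'a::field poly set"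
  assumes I: "is_ideal I" and "\<exists>p\<in>I. p \<noteq> 0"
  shows "\<exists>g. lead_coeff g = 1 \<and> I = {p. g dvd p}"
proof -
  obtain p0 where "p0 \<in> I \<and> p0 \<noteq> 0" using assms(2) by blast
  from ex_has_least_nat[of "\<lambda>p. p \<in> I \<and> p \<noteq> 0", OF this, of degree]
  obtain p where p: "p \<in> I" "p \<noteq> 0" and min: "\<And>r. r \<in> I \<Longrightarrow> r \<noteq> 0 \<Longrightarrow> degree p \<le> degree r" by blast
  define g where "g = smult (inverse (lead_coeff p)) p"
  have g: "lead_coeff g = 1" "g \<in> I" "degree g = degree p"
    using p is_ideal_mult[OF I p(1), of "[:inverse (lead_coeff p):]"] by (simp_all add: g_def)
  have "g dvd r" if "r \<in> I" for r
  proof (rule ccontr)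
    assume "\<not> g dvd r"
    hence "r mod g \<noteq> 0" by (simp add: mod_eq_0_iff_dvd)
    moreover have "r mod g = r - r div g * g" by (simp add: minus_div_mult_eq_mod)
    hence "r mod g \<in> I" using is_ideal_diff[OF I that is_ideal_mult[OF I g(2)]] by simp
    ultimately show False
      using min[of "r mod g"] degree_mod_less[of g r] g p(2) by fastforce
  qed
  moreover have "r \<in> I" if "g dvd r" for r
    using that is_ideal_mult[OF I g(2)] by (metis dvdE mult.commute)
  ultimately show ?thesis using g(1) by blast
qed

text \<open>The ideal generated by \<open>a\<close> and \<open>b\<close> is principal;
  \<open>d\<close> is its monic generator.\<close>

lemma poly_monic_gcd_bezout:
  fixes a b :: "'a::field poly"
  assumes "a \<noteq> 0"
  shows "\<exists>d u v. lead_coeff d = 1 \<and> d dvd a \<and> d dvd b \<and> d = u * a + v * b"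
proof -
  define I where "I = {u * a + v * b | u v. True}"
  have "is_ideal I"
    unfolding is_ideal_def
  proof (intro conjI ballI allI)
    show "0 \<in> I" unfolding I_def by (rule CollectI, rule exI[of _ 0], rule exI[of _ 0]) simp
    fix x r assume "x \<in> I"
    then obtain u v where x: "x = u * a + v * b" by (auto simp: I_def)
    show "r * x \<in> I" unfolding I_def
      by (rule CollectI, rule exI[of _ "r * u"], rule exI[of _ "r * v"]) (simp add: x algebra_simps)
    fix y assume "y \<in> I"
    then obtain u' v' where y: "y = u' * a + v' * b" by (auto simp: I_def)
    show "x + y \<in> I" unfolding I_def
      by (rule CollectI, rule exI[of _ "u + u'"], rule exI[of _ "v + v'"]) (simp add: x y algebra_simps)
  qed
  moreover have a: "a \<in> I" unfolding I_def by (rule CollectI, rule exI[of _ 1], rule exI[of _ 0]) simp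
  have b: "b \<in> I" unfolding I_def by (rule CollectI, rule exI[of _ 0], rule exI[of _ 1]) simp
  ultimately obtain d where d: "lead_coeff d = 1" "I = {p. d dvd p}"
    using ideal_poly_principal[of I] a assms by blast
  moreover have "d \<in> I" using d(2) by simp
  then obtain u v where "d = u * a + v * b" by (auto simp: I_def)
  ultimately show ?thesis using a b by blast
qed

lemma coprime_poly_iff_bezout:
  fixes a b :: "'a::field poly"
  shows "coprime a b \<longleftrightarrow> (\<exists>u v. u * a + v * b = 1)"
proof
  assume c: "coprime a b"
  show "\<exists>u v. u * a + v * b = 1"
  proof (cases "a = 0")
    case True
    with c have "b dvd 1" by simp
    then obtain w where "1 = b * w" by (rule dvdE)
    hence "0 * a + w * b = 1" by (simp add: mult.commute)
    thus ?thesis by blast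
  next
    case False
    then obtain d u v where d: "d dvd a" "d dvd b" "d = u * a + v * b"
      using poly_monic_gcd_bezout by blast
    with c have "d dvd 1" by (simp add: coprime_def)
    then obtain w where "1 = d * w" by (rule dvdE)
    hence "(w * u) * a + (w * v) * b = 1" using d(3) by (simp add: algebra_simps)
    thus ?thesis by blast
  qed
next
  assume "\<exists>u v. u * a + v * b = 1"
  then obtain u v where uv: "u * a + v * b = 1" by blast
  show "coprime a b"
  proof (rule coprimeI)
    fix c assume "c dvd a" "c dvd b"
    hence "c dvd u * a + v * b" by simp
    thus "is_unit c" using uv by simp
  qed
qed

text \<open>Stated by coefficients rather than by \<open>degree\<close>, so that the zero polynomial
  needs no exception and \<open>deg_lt 0\<close> is \<open>{0}\<close>.\<close>

definition deg_lt :: "nat \<Rightarrow> 'a::zero poly set"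
  where "deg_lt k = {F. \<forall>i\<ge>k. coeff F i = 0}"

lemma deg_lt_0: "deg_lt 0 = {0}"
  by (auto simp: deg_lt_def poly_eq_iff)

lemma deg_lt_mono: "i \<le> j \<Longrightarrow> deg_lt i \<subseteq> deg_lt j"
  by (auto simp: deg_lt_def)

lemma deg_lt_diff: "a \<in> deg_lt k \<Longrightarrow> b \<in> deg_lt k \<Longrightarrow> a - b \<in> deg_lt k"
  and deg_lt_add: "a \<in> deg_lt k \<Longrightarrow> b \<in> deg_lt k \<Longrightarrow> a + b \<in> deg_lt k"
  for a :: "'a::ab_group_add poly"
  by (auto simp: deg_lt_def)

lemma deg_lt_smult: "a \<in> deg_lt k \<Longrightarrow> smult c a \<in> deg_lt k"
  by (auto simp: deg_lt_def)

lemma deg_lt_pCons: "a \<in> deg_lt k \<Longrightarrow> pCons c a \<in> deg_lt (Suc k)"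
  by (auto simp: deg_lt_def coeff_pCons split: nat.splits)

lemma subgrp_deg_lt: "subgrp (deg_lt k :: 'a::ab_group_add poly set)"
  unfolding subgrp_def by (auto simp: deg_lt_def)

lemma deg_ltI: "degree p < k \<Longrightarrow> p \<in> deg_lt k"
  by (auto simp: deg_lt_def coeff_eq_0)

lemma deg_lt_iff: "p \<in> deg_lt k \<longleftrightarrow> p = 0 \<or> degree p < k"
  using leading_coeff_0_iff[of p] by (auto simp: deg_lt_def coeff_eq_0 not_less)

text \<open>Each of the \<open>k\<close> coefficients is chosen freely in \<open>S\<close>. This is
  applied with \<open>S\<close> all scalars, the residues modulo \<open>g\<close>, and the constants
  among the coefficients in x.\<close>

lemma card_deg_lt_coeffs:
  assumes "0 \<in> S"
  shows "card {p \<in> deg_lt k. \<forall>i. coeff p i \<in> S} = card S ^ k"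
proof (induction k)
  case 0
  have "{p \<in> deg_lt 0. \<forall>i. coeff p i \<in> S} = {0}" using assms by (auto simp: deg_lt_0)
  thus ?case by simp
next
  case (Suc k)
  let ?P = "\<lambda>k. {p \<in> deg_lt k. \<forall>i. coeff p i \<in> S}"
  have "?P (Suc k) = (\<lambda>(c, p). pCons c p) ` (S \<times> ?P k)"
  proof
    show "?P (Suc k) \<subseteq> (\<lambda>(c, p). pCons c p) ` (S \<times> ?P k)"
    proof
      fix p assume p: "p \<in> ?P (Suc k)"
      obtain c r where pc: "p = pCons c r" by (cases p)
      have "coeff r i = coeff p (Suc i)" for i by (simp add: pc)
      hence "r \<in> ?P k" using p by (auto simp: deg_lt_def)
      moreover have "c = coeff p 0" by (simp add: pc)
      hence "c \<in> S" using p by auto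
      ultimately show "p \<in> (\<lambda>(c, p). pCons c p) ` (S \<times> ?P k)" using pc by auto
    qed
    show "(\<lambda>(c, p). pCons c p) ` (S \<times> ?P k) \<subseteq> ?P (Suc k)"
      by (auto simp: deg_lt_pCons coeff_pCons split: nat.splits)
  qed
  moreover have "inj_on (\<lambda>(c, p). pCons c p) (S \<times> ?P k)"
    by (auto simp: inj_on_def)
  ultimately have "card (?P (Suc k)) = card (S \<times> ?P k)" by (simp add: card_image)
  thus ?case using Suc by (simp add: card_cartesian_product)
qed

lemma card_deg_lt: "card (deg_lt k :: 'a::zero poly set) = CARD('a) ^ k"
  using card_deg_lt_coeffs[of UNIV k] by simp

lemma deg_lt_Suc: "F \<in> deg_lt (Suc k) \<Longrightarrow> coeff F k = 0 \<Longrightarrow> F \<in> deg_lt k"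
  unfolding deg_lt_def by clarify (metis le_eq_less_or_eq Suc_leI)

definition monics :: "nat \<Rightarrow> 'a::comm_ring_1 poly set"
  where "monics k = {F \<in> deg_lt (Suc k). coeff F k = 1}"

lemma monics_iff: "F \<in> monics k \<longleftrightarrow> degree F = k \<and> lead_coeff F = 1"
proof
  assume F: "F \<in> monics k"
  hence "degree F \<le> k" by (auto simp: monics_def deg_lt_def intro!: degree_le)
  moreover have "k \<le> degree F" using F by (intro le_degree) (simp add: monics_def)
  ultimately show "degree F = k \<and> lead_coeff F = 1" using F by (simp add: monics_def)
qed (auto simp: monics_def deg_ltI)

lemma pCons_monics: "F \<in> monics k \<Longrightarrow> pCons c F \<in> monics (Suc k)"
  by (auto simp: monics_def deg_lt_pCons)

lemma monics_add: "F \<in> monics k \<Longrightarrow> a \<in> deg_lt k \<Longrightarrow> F + a \<in> monics k"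
  by (auto simp: monics_def deg_lt_def)

lemma monics_diff: "F \<in> monics k \<Longrightarrow> G \<in> monics k \<Longrightarrow> F - G \<in> deg_lt k"
  by (rule deg_lt_Suc) (auto simp: monics_def deg_lt_diff)

text \<open>Uniqueness in the division by a monic polynomial: a nonzero multiple of \<open>H\<close>
  has degree at least \<open>k\<close>.\<close>

lemma monics_mult_deg_lt:
  fixes H :: "'a::idom poly"
  assumes "H \<in> monics k" "Q * H \<in> deg_lt k"
  shows "Q = 0"
proof (rule ccontr)
  assume "Q \<noteq> 0"
  have "H \<noteq> 0" using assms(1) by (auto simp: monics_def)
  hence "degree (Q * H) = degree Q + k" "Q * H \<noteq> 0"
    using \<open>Q \<noteq> 0\<close> assms(1) by (simp_all add: degree_mult_eq monics_iff)
  thus False using assms(2) by (simp add: deg_lt_iff)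
qed

text \<open>Division by a monic polynomial, by Horner induction: multiply the previous remainder by
  the variable, add the new constant, and remove the coefficient at \<open>k\<close> with a multiple
  of \<open>H\<close>.\<close>

lemma ideal_reduce:
  fixes J :: "'a::comm_ring_1 poly set"
  assumes J: "is_ideal J" and H: "H \<in> J" "H \<in> monics k"
  shows "\<exists>F'\<in>deg_lt k. F - F' \<in> J"
proof (induction F)
  case 0
  show ?case by (rule bexI[of _ 0]) (auto simp: is_ideal_0[OF J] deg_lt_def)
next
  case (pCons a G)
  then obtain G' where G': "G' \<in> deg_lt k" "G - G' \<in> J" by blast
  define c where "c = coeff (pCons a G') k"
  define F' where "F' = pCons a G' - smult c H"
  have "F' \<in> deg_lt k"
    using deg_lt_pCons[OF G'(1), of a] H(2)
    by - (rule deg_lt_Suc, simp_all add: monics_def deg_lt_diff deg_lt_smult F'_def c_def)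
  moreover have "pCons a G - F' = [:0, 1:] * (G - G') + [:c:] * H"
    by (simp add: F'_def)
  hence "pCons a G - F' \<in> J"
    using is_ideal_add[OF J is_ideal_mult[OF J G'(2), of "[:0, 1:]"] is_ideal_mult[OF J H(1), of "[:c:]"]]
    by simp
  ultimately show ?case by blast
qed

lemma is_ideal_principal: "is_ideal {Q * H | Q. True}" for H :: "'a::comm_ring_1"
  unfolding is_ideal_def
proof (intro conjI ballI allI)
  show "0 \<in> {Q * H | Q. True}" by (rule CollectI, rule exI[of _ 0]) simp
  fix a r assume "a \<in> {Q * H | Q. True}"
  then obtain P where a: "a = P * H" by blast
  show "r * a \<in> {Q * H | Q. True}" by (rule CollectI, rule exI[of _ "r * P"]) (simp add: a mult.assoc)
  fix b assume "b \<in> {Q * H | Q. True}"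
  then obtain Q where b: "b = Q * H" by blast
  show "a + b \<in> {Q * H | Q. True}" by (rule CollectI, rule exI[of _ "P + Q"]) (simp add: a b distrib_right)
qed

lemma monic_div_mod:
  assumes "H \<in> monics k"
  shows "\<exists>Q. \<exists>F'\<in>deg_lt k. F = F' + Q * H"
proof -
  have "H \<in> {Q * H | Q. True}" by (rule CollectI, rule exI[of _ 1]) simp
  from ideal_reduce[OF is_ideal_principal this assms, of F]
  obtain F' Q where "F' \<in> deg_lt k" "F - F' = Q * H" by blast
  hence "F = F' + Q * H" by (simp add: diff_eq_eq add.commute)
  thus ?thesis using \<open>F' \<in> deg_lt k\<close> by blast
qed

text \<open>Every coset of \<open>J\<close> has a representative in \<open>deg_lt k\<close> by
  \<open>ideal_reduce\<close>, so the index can be computed among truncated polynomials.\<close>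

lemma idx_eq_rindex_deg_lt:
  assumes J: "is_ideal J" and H: "H \<in> J" "H \<in> monics k"
  shows "idx J = rindex (deg_lt k) (J \<inter> deg_lt k)"
proof -
  have sg: "subgrp J" using J by (rule is_ideal_subgrp)
  have "rcoset J ` UNIV = rcoset J ` deg_lt k"
  proof -
    have "rcoset J F \<in> rcoset J ` deg_lt k" for F
    proof -
      obtain F' where "F' \<in> deg_lt k" "F - F' \<in> J" using ideal_reduce[OF J H, of F] by blast
      hence "rcoset J F = rcoset J F'" by (simp add: rcoset_eq_iff[OF sg])
      thus ?thesis using \<open>F' \<in> deg_lt k\<close> by blast
    qed
    thus ?thesis by blast
  qed
  hence "idx J = card (rcoset J ` deg_lt k)" by (simp add: rindex_def)
  also have "\<dots> = rindex (deg_lt k) (J \<inter> deg_lt k)"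
    by (rule rindex_eq_card_image[symmetric])
      (simp_all add: rcoset_eq_iff[OF sg] subgrp_Int sg subgrp_deg_lt deg_lt_diff)
  finally show ?thesis .
qed


section \<open>Ideals glued from a polynomial and a smaller ideal\<close>

text \<open>
  Modulo \<open>g\<close>, the operator \<open>F \<mapsto> y F - c\<^sub>t(F) H\<close> shifts the coefficients of \<open>F\<close> upwards, so that
  each of them becomes a leading coefficient.
\<close>
lemma leading_divisor_dvd_coeffs:
  fixes J :: "'a::comm_ring_1 poly set"
  assumes J: "is_ideal J" and H: "H \<in> J" "H \<in> monics (Suc t)"
    and lead: "\<And>F. F \<in> J \<Longrightarrow> F \<in> deg_lt (Suc t) \<Longrightarrow> g dvd coeff F t"
    and F: "F \<in> J" "F \<in> deg_lt (Suc t)"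
  shows "g dvd coeff F i"
proof (cases "i \<le> t")
  case False
  thus ?thesis using F(2) by (simp add: deg_lt_def)
next
  case True
  have "\<forall>F\<in>J \<inter> deg_lt (Suc t). g dvd coeff F (t - d)" if "d \<le> t" for d
    using that
  proof (induction d)
    case 0
    thus ?case using lead by simp
  next
    case (Suc d)
    show ?case
    proof
      fix F assume F: "F \<in> J \<inter> deg_lt (Suc t)"
      define F' where "F' = pCons 0 F - smult (coeff F t) H"
      have "F' = [:0, 1:] * F - [:coeff F t:] * H" by (simp add: F'_def)
      hence "F' \<in> J" using F H(1) by (simp only: is_ideal_diff[OF J] is_ideal_mult[OF J] Int_iff)
      moreover have "F' \<in> deg_lt (Suc (Suc t))"
        using F H(2) by (simp add: F'_def monics_def deg_lt_diff deg_lt_smult deg_lt_pCons)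
      hence "F' \<in> deg_lt (Suc t)"
        by (rule deg_lt_Suc) (use H(2) in \<open>simp add: F'_def monics_def\<close>)
      ultimately have "g dvd coeff F' (t - d)" using Suc by simp
      moreover have "t - d = Suc (t - Suc d)" using Suc.prems by simp
      hence "coeff F (t - Suc d) = coeff F' (t - d) + coeff F t * coeff H (t - d)"
        by (simp add: F'_def)
      ultimately show "g dvd coeff F (t - Suc d)" using lead[of F] F by simp
    qed
  qed
  from this[of "t - i"] True F show ?thesis by simp
qed

definition glue :: "'a::comm_ring_1 \<Rightarrow> 'a poly set \<Rightarrow> 'a poly \<Rightarrow> 'a poly set"
  where "glue g J H = {smult g F + K * H | F K. F \<in> J}"

lemma glueI: "F \<in> J \<Longrightarrow> smult g F + K * H \<in> glue g J H"
  by (auto simp: glue_def)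

lemma is_ideal_glue:
  assumes J: "is_ideal J"
  shows "is_ideal (glue g J H)"
  unfolding is_ideal_def
proof (intro conjI ballI allI)
  show "0 \<in> glue g J H" using glueI[OF is_ideal_0[OF J], of g 0 H] by simp
  fix a r assume "a \<in> glue g J H"
  then obtain F K where a: "a = smult g F + K * H" "F \<in> J" by (auto simp: glue_def)
  have "r * a = smult g (r * F) + (r * K) * H" by (simp add: a(1) algebra_simps)
  thus "r * a \<in> glue g J H" by (simp only: glueI is_ideal_mult[OF J a(2)])
  fix b assume "b \<in> glue g J H"
  then obtain F' K' where b: "b = smult g F' + K' * H" "F' \<in> J" by (auto simp: glue_def)
  have "a + b = smult g (F + F') + (K + K') * H" by (simp add: a(1) b(1) algebra_simps smult_add_right)
  thus "a + b \<in> glue g J H" by (simp only: glueI is_ideal_add[OF J a(2) b(2)])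
qed

text \<open>Here \<open>J\<close> is the smaller ideal, the J' of the opening explanation; the
  larger one is \<open>glue g J H\<close>. The next lemmas recover \<open>J\<close>,
  \<open>g\<close> and the class of \<open>H\<close> from the glued ideal.\<close>

locale glueing =
  fixes g :: "'a::idom" and J :: "'a poly set" and t :: nat
  assumes g: "g \<noteq> 0" and J: "is_ideal J" and monic: "\<exists>h\<in>J. h \<in> monics t"
begin

abbreviation "M \<equiv> J \<inter> deg_lt (Suc t)"

lemma subgrp_M: "subgrp M"
  by (intro subgrp_Int is_ideal_subgrp J subgrp_deg_lt)

lemma smult_in_J: "F \<in> J \<Longrightarrow> smult c F \<in> J"
  using is_ideal_mult[OF J, of F "[:c:]"] by simp

context
  fixes H assumes H: "H \<in> J" "H \<in> monics (Suc t)"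
begin

lemma H_in_glue: "H \<in> glue g J H"
  using glueI[OF is_ideal_0[OF J], of g 1 H] by simp

lemma glue_subset: "glue g J H \<subseteq> J"
  unfolding glue_def using H by (auto intro!: is_ideal_add[OF J] is_ideal_mult[OF J] smult_in_J)

text \<open>In \<open>smult g F + K * H\<close> replace \<open>F\<close> by its remainder modulo
  \<open>H\<close>. What is left over is a multiple of \<open>H\<close> of degree at most
  \<open>t\<close>, hence 0. All later facts about \<open>glue\<close> rest on this
  description.\<close>

lemma glue_truncation: "glue g J H \<inter> deg_lt (Suc t) = smult g ` M"
proof
  show "smult g ` M \<subseteq> glue g J H \<inter> deg_lt (Suc t)"
    using glueI[of _ J g 0 H] by (auto simp: deg_lt_smult)
  show "glue g J H \<inter> deg_lt (Suc t) \<subseteq> smult g ` M"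
  proof
    fix a assume a: "a \<in> glue g J H \<inter> deg_lt (Suc t)"
    then obtain F K where FK: "a = smult g F + K * H" "F \<in> J" by (auto simp: glue_def)
    obtain Q F' where F': "F' \<in> deg_lt (Suc t)" "F = F' + Q * H"
      using monic_div_mod[OF H(2), of F] by blast
    have "F' = F - Q * H" using F' by simp
    hence "F' \<in> J" using is_ideal_diff[OF J FK(2) is_ideal_mult[OF J H(1)]] by simp
    have "(smult g Q + K) * H = a - smult g F'"
      by (simp add: FK F'(2) algebra_simps smult_add_right)
    moreover have "a - smult g F' \<in> deg_lt (Suc t)" using a F' by (simp add: deg_lt_diff deg_lt_smult)
    ultimately have "smult g Q + K = 0" using monics_mult_deg_lt[OF H(2)] by metis
    hence "a = smult g F'" using \<open>_ = a - smult g F'\<close> by simp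
    thus "a \<in> smult g ` M" using \<open>F' \<in> J\<close> F' by blast
  qed
qed

text \<open>\<open>J\<close> is recovered as the colon ideal by \<open>g\<close>. Modulo
  \<open>H\<close> one may assume that \<open>F\<close> is truncated; then
  \<open>glue_truncation\<close> applies and \<open>g\<close> cancels.\<close>

lemma glue_colon: "{F. smult g F \<in> glue g J H} = J"
proof
  show "J \<subseteq> {F. smult g F \<in> glue g J H}" using glueI[of _ J g 0 H] by auto
  show "{F. smult g F \<in> glue g J H} \<subseteq> J"
  proof clarify
    fix F assume F: "smult g F \<in> glue g J H"
    obtain Q F' where F': "F' \<in> deg_lt (Suc t)" "F = F' + Q * H"
      using monic_div_mod[OF H(2), of F] by blast
    have "smult g F' = smult g F - smult g Q * H" by (simp add: F'(2) smult_add_right)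
    hence "smult g F' \<in> glue g J H"
      by (simp only: is_ideal_diff is_ideal_glue J F is_ideal_mult H_in_glue)
    hence "smult g F' \<in> smult g ` M" using glue_truncation F'(1) by (auto simp: deg_lt_smult)
    then obtain m where m: "m \<in> J" "smult g F' = smult g m" by blast
    have "smult g (F' - m) = 0" using m(2) by (simp add: smult_diff_right)
    hence "F' \<in> J" using g m(1) by simp
    thus "F \<in> J" unfolding F'(2) using is_ideal_add[OF J] is_ideal_mult[OF J H(1)] by blast
  qed
qed

text \<open>\<open>g\<close> is recovered, up to units, from the coefficients at \<open>t\<close>:
  they are divisible by \<open>g\<close> by \<open>glue_truncation\<close>, and the monic element of
  degree \<open>t\<close> in \<open>J\<close> makes every multiple of \<open>g\<close>
  occur.\<close>

lemma glue_leading: "(\<exists>F\<in>glue g J H \<inter> deg_lt (Suc t). coeff F t = c) \<longleftrightarrow> g dvd c"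
  unfolding glue_truncation
proof
  assume "g dvd c"
  then obtain c' where c: "c = g * c'" by (rule dvdE)
  obtain h where h: "h \<in> J" "h \<in> monics t" using monic by blast
  have "smult c' h \<in> M" using h smult_in_J by (simp add: monics_def deg_lt_smult)
  moreover have "coeff (smult g (smult c' h)) t = c" using h(2) by (simp add: c monics_def)
  ultimately show "\<exists>F\<in>smult g ` M. coeff F t = c" by blast
qed auto

text \<open>The difference of two monic polynomials of degree \<open>t + 1\<close> is truncated, so
  it lies in the common ideal iff it lies in \<open>smult g\<close> followed by \<open>M\<close>.
  Conversely such a difference is absorbed into the \<open>J\<close>-component.\<close>

lemma glue_eq_iff:
  assumes H': "H' \<in> J" "H' \<in> monics (Suc t)"
  shows "glue g J H = glue g J H' \<longleftrightarrow> H - H' \<in> smult g ` M"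
proof
  assume eq: "glue g J H = glue g J H'"
  have "H' \<in> glue g J H" using glueI[OF is_ideal_0[OF J], of g 1 H'] eq by simp
  hence "H - H' \<in> glue g J H" by (rule is_ideal_diff[OF is_ideal_glue[OF J] H_in_glue])
  thus "H - H' \<in> smult g ` M" using monics_diff[OF H(2) H'(2)] glue_truncation by blast
next
  assume "H - H' \<in> smult g ` M"
  then obtain m where m: "H = H' + smult g m" "m \<in> J" by (auto simp: diff_eq_eq add.commute)
  have e1: "smult g F + K * H = smult g (F + K * m) + K * H'"
    and e2: "smult g F + K * H' = smult g (F - K * m) + K * H" for F K
    by (simp_all add: m(1) algebra_simps smult_add_right smult_diff_right)
  have "F + K * m \<in> J" "F - K * m \<in> J" if "F \<in> J" for F K
    using that m(2) by (simp_all add: is_ideal_add[OF J] is_ideal_diff[OF J] is_ideal_mult[OF J])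
  hence "smult g F + K * H \<in> glue g J H'" "smult g F + K * H' \<in> glue g J H"
    if "F \<in> J" for F K
    using that unfolding e1[of F K] e2[of F K] by (auto intro: glueI)
  thus "glue g J H = glue g J H'" by (auto simp: glue_def[of g J H] glue_def[of g J H'])
qed

end
end

lemma glue_decomposition:
  fixes J :: "'a::idom poly set"
  assumes J: "is_ideal J" and H: "H \<in> J" "H \<in> monics (Suc t)"
    and g: "\<And>c. (\<exists>F\<in>J \<inter> deg_lt (Suc t). coeff F t = c) \<longleftrightarrow> g dvd c" and "g \<noteq> 0"
  defines "J' \<equiv> {F. smult g F \<in> J}"
  shows "is_ideal J'" "J \<subseteq> J'" "\<exists>h\<in>J'. h \<in> monics t" "J = glue g J' H"
proof -
  have sJ: "smult c F \<in> J" if "F \<in> J" for c F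
    using is_ideal_mult[OF J that, of "[:c:]"] by simp
  show J': "is_ideal J'"
    unfolding is_ideal_def J'_def
  proof (intro conjI ballI allI)
    fix r F assume "F \<in> {F. smult g F \<in> J}"
    thus "r * F \<in> {F. smult g F \<in> J}" using is_ideal_mult[OF J, of "smult g F" r] by simp
  qed (auto simp: is_ideal_0[OF J] smult_add_right is_ideal_add[OF J])
  show "J \<subseteq> J'" using sJ by (auto simp: J'_def)
  have div: "\<exists>m\<in>deg_lt (Suc t) \<inter> J'. F = smult g m" if F: "F \<in> J" "F \<in> deg_lt (Suc t)" for F
  proof -
    have "g dvd coeff F i" for i
      by (rule leading_divisor_dvd_coeffs[OF J H _ F]) (subst g[symmetric], blast)
    \<comment> \<open>The quotients \<open>c i\<close> form a polynomial: beyond \<open>t\<close>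
      the product \<open>g * c i\<close> is 0, and \<open>g\<close> cancels.\<close>
    then obtain c where c: "\<And>i. coeff F i = g * c i" unfolding dvd_def by metis
    have c0: "c i = 0" if "i > t" for i using F(2) c[of i] \<open>g \<noteq> 0\<close> that by (simp add: deg_lt_def)
    have "\<forall>\<^sub>\<infinity>i. c i = 0" unfolding MOST_nat using c0 by blast
    hence cc: "coeff (Abs_poly c) i = c i" for i by (simp add: Abs_poly_inverse)
    have "F = smult g (Abs_poly c)" by (simp add: poly_eq_iff cc c)
    moreover have "Abs_poly c \<in> deg_lt (Suc t)" by (simp add: deg_lt_def cc c0)
    ultimately show ?thesis using F by (auto simp: J'_def)
  qed
  \<comment> \<open>An element with leading coefficient exactly \<open>g\<close>, divided by
    \<open>g\<close>, is the required monic element of degree \<open>t\<close>.\<close>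
  have "\<exists>F\<in>J \<inter> deg_lt (Suc t). coeff F t = g" by (simp only: g dvd_refl)
  then obtain G where G: "G \<in> J \<inter> deg_lt (Suc t)" "coeff G t = g" by blast
  then obtain h where h: "h \<in> deg_lt (Suc t)" "h \<in> J'" "G = smult g h" using div[of G] by blast
  have "h \<in> monics t" using h G(2) \<open>g \<noteq> 0\<close> by (simp add: monics_def)
  thus "\<exists>h\<in>J'. h \<in> monics t" using h by blast
  show "J = glue g J' H"
  proof
    show "glue g J' H \<subseteq> J"
      unfolding glue_def J'_def using H(1) by (auto intro!: is_ideal_add[OF J] is_ideal_mult[OF J])
    show "J \<subseteq> glue g J' H"
    proof
      fix F assume F: "F \<in> J"
      obtain Q F' where F': "F' \<in> deg_lt (Suc t)" "F = F' + Q * H"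
        using monic_div_mod[OF H(2), of F] by blast
      have "F' = F - Q * H" using F' by simp
      hence "F' \<in> J" using is_ideal_diff[OF J F is_ideal_mult[OF J H(1)]] by simp
      then obtain m where "m \<in> J'" "F' = smult g m" using div[OF _ F'(1)] by blast
      thus "F \<in> glue g J' H" by (simp only: F'(2) glueI)
    qed
  qed
qed

section \<open>Existence of the leading generator and indices of glued ideals\<close>

lemma poly_mod_eq_self_iff:
  fixes g :: "'a::field poly"
  assumes "g \<in> monics e"
  shows "u mod g = u \<longleftrightarrow> u \<in> deg_lt e" and "u mod g \<in> deg_lt e"
proof -
  have g: "degree g = e" "g \<noteq> 0" using assms by (auto simp: monics_iff)
  show *: "u mod g \<in> deg_lt e" for u
    using degree_mod_less[OF g(2), of u] g(1) by (auto simp: deg_lt_iff)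
  show "u mod g = u \<longleftrightarrow> u \<in> deg_lt e"
    using *[of u] mod_poly_less[of u g] g(1) by (auto simp: deg_lt_iff)
qed

text \<open>The infinitely many powers of x cannot all be distinct modulo \<open>J\<close>; the
  difference of two of them is the wanted polynomial in x alone.\<close>

lemma ideal_nontrivial_of_idx:
  fixes J :: "'a::idom poly poly set"
  assumes J: "is_ideal J" "idx J > 0"
  shows "\<exists>p. p \<noteq> 0 \<and> [:p:] \<in> J"
proof -
  define A where "A = range (\<lambda>n. [:monom (1::'a) n:])"
  have "inj (\<lambda>n. [:monom (1::'a) n:])" by (auto simp: inj_def monom_eq_iff')
  hence "infinite A" unfolding A_def using finite_imageD infinite_UNIV_nat by blast
  then obtain a b where ab: "a \<in> A" "b \<in> A" "a \<noteq> b" "a - b \<in> J"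
    using rindex_pigeonhole[OF is_ideal_subgrp[OF J(1)] _ J(2), of A] by blast
  then obtain i j where "a = [:monom 1 i:]" "b = [:monom 1 j:]" by (auto simp: A_def)
  with ab have "[:monom 1 i - monom 1 j:] \<in> J" "monom 1 i - monom 1 j \<noteq> (0::'a poly)" by auto
  thus ?thesis by blast
qed

text \<open>The coefficients at \<open>t\<close> form an ideal \<open>I\<close> of k[x]. It is
  nonzero because p y^t lies in \<open>J\<close> for the \<open>p\<close> of
  \<open>ideal_nontrivial_of_idx\<close>.\<close>

lemma ideal_leading_generator:
  fixes J :: "'a::field poly poly set"
  assumes J: "is_ideal J" "idx J > 0"
  shows "\<exists>g. lead_coeff g = 1 \<and> (\<forall>c. (\<exists>F\<in>J \<inter> deg_lt (Suc t). coeff F t = c) \<longleftrightarrow> g dvd c)"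
proof -
  define I where "I = {c. \<exists>F\<in>J \<inter> deg_lt (Suc t). coeff F t = c}"
  have I: "coeff F t \<in> I" if "F \<in> J" "F \<in> deg_lt (Suc t)" for F using that by (auto simp: I_def)
  have "is_ideal I"
    unfolding is_ideal_def
  proof (intro conjI ballI allI)
    show "0 \<in> I" using I[OF is_ideal_0[OF J(1)]] by (simp add: deg_lt_def)
    fix a r assume "a \<in> I"
    then obtain F where F: "F \<in> J" "F \<in> deg_lt (Suc t)" "a = coeff F t" by (auto simp: I_def)
    show "r * a \<in> I"
      using I[of "smult r F"] is_ideal_mult[OF J(1) F(1), of "[:r:]"] F by (simp add: deg_lt_smult)
    fix b assume "b \<in> I"
    then obtain G where G: "G \<in> J" "G \<in> deg_lt (Suc t)" "b = coeff G t" by (auto simp: I_def)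
    show "a + b \<in> I"
      using I[of "F + G"] is_ideal_add[OF J(1) F(1) G(1)] F G by (simp add: deg_lt_add)
  qed
  moreover obtain p where p: "p \<noteq> 0" "[:p:] \<in> J" using ideal_nontrivial_of_idx[OF J] by blast
  have "monom p t \<in> J" using is_ideal_mult[OF J(1) p(2), of "monom 1 t"]
    by (simp add: mult.commute[of "monom 1 t"] smult_monom)
  hence "p \<in> I" using I[of "monom p t"] by (simp add: deg_lt_def)
  ultimately obtain g where g: "lead_coeff g = 1" "I = {c. g dvd c}"
    using ideal_poly_principal[of I] p(1) by blast
  have "(\<exists>F\<in>J \<inter> deg_lt (Suc t). coeff F t = c) \<longleftrightarrow> c \<in> I" for c by (simp add: I_def)
  thus ?thesis using g by auto
qed

lemma monic_dvd_antisym: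
  fixes g g' :: "'a::field poly"
  assumes "lead_coeff g = 1" "lead_coeff g' = 1" "g dvd g'" "g' dvd g"
  shows "g = g'"
proof -
  obtain u where u: "g' = g * u" using assms(3) by (rule dvdE)
  obtain v where v: "g = g' * v" using assms(4) by (rule dvdE)
  have "g \<noteq> 0" using assms(1) by auto
  moreover have "g * 1 = g * (u * v)" using u v by (metis mult.assoc mult.right_neutral)
  ultimately have "u * v = 1" by (metis mult_left_cancel)
  hence "is_unit u" by (metis dvd_triv_left)
  then obtain c where c: "u = [:c:]" by (auto simp: is_unit_poly_iff)
  have "lead_coeff g' = lead_coeff g * c" unfolding u c by (simp only: lead_coeff_mult lead_coeff_pCons)
  hence "c = 1" using assms(1,2) by simp
  thus ?thesis using u c by simp
qed

locale field_glueing = glueing g J t for g :: "'a::{field, finite} poly" and J t +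
  fixes e :: nat
  assumes g_monic: "g \<in> monics e" and idx_pos: "idx J > 0"
begin

abbreviation "V \<equiv> deg_lt (Suc t) :: 'a poly poly set"

lemma smult_image_subgrp: "subgrp (smult g ` A)" if "subgrp A"
  using that unfolding subgrp_def by (auto simp: smult_diff_right[symmetric] intro!: image_eqI[of 0 _ 0])

lemma inj_smult_g: "inj (smult g)"
proof (rule injI)
  fix x y assume "smult g x = smult g y"
  hence "smult g (x - y) = 0" by (simp add: smult_diff_right)
  thus "x = y" using g by simp
qed

text \<open>Reduction of all coefficients modulo \<open>g\<close> has kernel \<open>smult g\<close>
  applied to \<open>V\<close>; its image consists of \<open>t + 1\<close> free residues, with q^e
  choices each.\<close>

lemma rindex_V_smult: "rindex V (smult g ` V) = CARD('a) ^ (e * Suc t)"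
proof -
  define f where "f = map_poly (\<lambda>p. p mod g)"
  have f: "coeff (f p) i = coeff p i mod g" for p i by (simp add: f_def coeff_map_poly)
  have ker: "f a = f b \<longleftrightarrow> a - b \<in> smult g ` V" if ab: "a \<in> V" "b \<in> V" for a b
  proof
    assume "f a = f b"
    hence "coeff a i mod g = coeff b i mod g" for i by (metis f)
    hence "g dvd coeff (a - b) i" for i by (simp add: mod_eq_dvd_iff)
    hence "a - b = smult g (map_poly (\<lambda>p. p div g) (a - b))"
      by (simp add: poly_eq_iff coeff_map_poly del: coeff_diff)
    moreover have "map_poly (\<lambda>p. p div g) (a - b) \<in> V"
      using deg_lt_diff[OF ab] by (simp add: deg_lt_def coeff_map_poly)
    ultimately show "a - b \<in> smult g ` V" by blast
  next
    assume "a - b \<in> smult g ` V"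
    then obtain m where m: "a = b + smult g m" by (auto simp: diff_eq_eq add.commute)
    show "f a = f b" by (simp add: poly_eq_iff f m)
  qed
  have "f ` V = {p \<in> V. \<forall>i. coeff p i \<in> deg_lt e}"
  proof
    show "f ` V \<subseteq> {p \<in> V. \<forall>i. coeff p i \<in> deg_lt e}"
      using poly_mod_eq_self_iff(2)[OF g_monic] by (auto simp: f deg_lt_def[of "Suc t"])
    show "{p \<in> V. \<forall>i. coeff p i \<in> deg_lt e} \<subseteq> f ` V"
    proof
      fix p assume "p \<in> {p \<in> V. \<forall>i. coeff p i \<in> deg_lt e}"
      hence "p \<in> V" "f p = p"
        using poly_mod_eq_self_iff(1)[OF g_monic] by (auto simp: poly_eq_iff f)
      thus "p \<in> f ` V" by (metis imageI)
    qed
  qed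
  hence "card (f ` V) = card (deg_lt e :: 'a poly set) ^ Suc t"
    by (simp only:) (rule card_deg_lt_coeffs, simp add: deg_lt_def)
  hence "rindex V (smult g ` V) = card (deg_lt e :: 'a poly set) ^ Suc t"
    using rindex_eq_card_image[of "smult g ` V" V f] ker smult_image_subgrp[OF subgrp_deg_lt] by simp
  thus ?thesis by (simp only: card_deg_lt power_mult)
qed

text \<open>\<open>M\<close> is truncated one degree above the monic element \<open>h\<close>; the
  index is still that of \<open>J\<close>, as seen from the monic multiple y h of degree
  \<open>t + 1\<close>.\<close>

lemma idx_M: "rindex V M = idx J"
proof -
  obtain h where "h \<in> J" "h \<in> monics t" using monic by blast
  hence "[:0, 1:] * h \<in> J" "[:0, 1:] * h \<in> monics (Suc t)"
    by (simp_all only: is_ideal_mult[OF J]) (simp add: pCons_monics)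
  from idx_eq_rindex_deg_lt[OF J this] show ?thesis by simp
qed

text \<open>Tower law along the chain gM, gV, V, where multiplication by \<open>g\<close> is
  injective and turns the index of \<open>M\<close> in \<open>V\<close> into that of gM in
  gV.\<close>

lemma rindex_V_M: "rindex V (smult g ` M) = CARD('a) ^ (e * Suc t) * idx J"
proof -
  have "rindex V (smult g ` M) = rindex V (smult g ` V) * rindex (smult g ` V) (smult g ` M)"
    by (rule rindex_mult) (auto simp: subgrp_deg_lt smult_image_subgrp subgrp_M deg_lt_smult)
  also have "rindex (smult g ` V) (smult g ` M) = rindex V M"
    by (rule rindex_image) (auto simp: subgrp_M smult_image_subgrp smult_diff_right inj_smult_g)
  finally show ?thesis by (simp add: idx_M rindex_V_smult)
qed

lemma idx_glue:
  assumes H: "H \<in> J" "H \<in> monics (Suc t)"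
  shows "idx (glue g J H) = CARD('a) ^ (e * Suc t) * idx J"
  using idx_eq_rindex_deg_lt[OF is_ideal_glue[OF J] H_in_glue[OF H] H(2)] glue_truncation[OF H]
  by (simp add: rindex_V_M)

text \<open>Comparison of the two chains from gM to \<open>V\<close>, one through gV and the other
  through \<open>M\<close>; the finite index of \<open>J\<close> cancels.\<close>

lemma rindex_M: "rindex M (smult g ` M) = CARD('a) ^ (e * Suc t)"
proof -
  have "rindex V (smult g ` M) = rindex V M * rindex M (smult g ` M)"
    by (rule rindex_mult) (auto simp: subgrp_deg_lt smult_image_subgrp subgrp_M smult_in_J deg_lt_smult)
  thus ?thesis using idx_pos by (simp add: idx_M rindex_V_M)
qed

text \<open>By \<open>y_inv_glue\<close> below, coprimality is what keeps y invertible modulo the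
  glued ideal.\<close>

definition glue_gens :: "'a poly poly set"
  where "glue_gens = {H \<in> J. H \<in> monics (Suc t) \<and> coprime (coeff H 0) g}"

text \<open>By \<open>glue_eq_iff\<close> the ideals correspond to the cosets of gM among the
  admissible \<open>H\<close>. The constant coefficient maps \<open>M\<close> onto all residues
  modulo \<open>g\<close>, with equally many cosets of gM over each, so it suffices to count the
  coprime residues.\<close>

lemma card_glue_gens:
  assumes F1: "\<exists>F\<in>J. coeff F 0 = 1"
  shows "card (glue g J ` glue_gens) = CARD('a) ^ (e * t) * card {u \<in> deg_lt e. coprime u g}"
proof -
  obtain h where h: "h \<in> J" "h \<in> monics t" using monic by blast
  \<comment> \<open>y h serves as base point because its constant coefficient is 0: for
    \<open>H = H0 + m\<close> the coprimality condition concerns \<open>m\<close> alone.\<close>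
  define H0 where "H0 = pCons 0 h"
  have H0: "H0 \<in> J" "H0 \<in> monics (Suc t)" "coeff H0 0 = 0"
    using is_ideal_mult[OF J h(1), of "[:0, 1:]"] h(2) by (simp_all add: H0_def pCons_monics)
  define f where "f m = coeff m 0 mod g" for m :: "'a poly poly"
  define T where "T = {u \<in> deg_lt e. coprime u g}"
  define K where "K = {m \<in> M. g dvd coeff m 0}"
  define Y where "Y = {m \<in> M. f m \<in> T}"
  have K: "subgrp K" "smult g ` M \<subseteq> K" "K \<subseteq> M"
    using subgrp_M smult_in_J by (auto simp: K_def subgrp_def deg_lt_smult)
  have ker: "f a = f b \<longleftrightarrow> a - b \<in> K" if "a \<in> M" "b \<in> M" for a b
    using that subgrp_diff[OF subgrp_M that] by (simp add: f_def K_def mod_eq_dvd_iff)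
  have surj: "deg_lt e \<subseteq> f ` M"
  proof
    fix u :: "'a poly" assume u: "u \<in> deg_lt e"
    obtain F where F: "F \<in> J" "coeff F 0 = 1" using F1 by blast
    obtain Q F' where F': "F' \<in> deg_lt t" "smult u F = F' + Q * h"
      using monic_div_mod[OF h(2), of "smult u F"] by blast
    have "F' = smult u F - Q * h" using F' by simp
    hence "F' \<in> J" using is_ideal_diff[OF J smult_in_J[OF F(1)] is_ideal_mult[OF J h(1)]] by simp
    \<comment> \<open>Reducing modulo \<open>h\<close> alters the constant coefficient by that of
      \<open>Q * h\<close>. Adding back \<open>coeff Q 0\<close> times \<open>h\<close> repairs
      this, and its degree \<open>t\<close> is still allowed in \<open>M\<close>.\<close>
    define m where "m = F' + smult (coeff Q 0) h"
    have "F' \<in> V" using F'(1) deg_lt_mono[of t "Suc t"] by auto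
    hence "m \<in> M" using \<open>F' \<in> J\<close> h smult_in_J
      by (simp add: m_def is_ideal_add[OF J] deg_lt_add deg_lt_smult monics_def)
    moreover have "coeff m 0 = coeff (smult u F) 0"
      by (simp add: m_def F'(2) coeff_mult)
    hence "f m = u" using u F(2) poly_mod_eq_self_iff(1)[OF g_monic] by (simp add: f_def)
    ultimately show "u \<in> f ` M" by blast
  qed
  have count: "rindex {m \<in> M. f m \<in> T'} (smult g ` M) = card T' * rindex K (smult g ` M)"
    if "T' \<subseteq> deg_lt e" for T'
    using K ker surj that
    by (intro rindex_vimage) (auto simp: subgrp_M smult_image_subgrp)
  \<comment> \<open>Applying \<open>count\<close> to the set of all residues yields the index of gM
    in \<open>K\<close>, as the index of gM in \<open>M\<close> is known.\<close>
  have "{m \<in> M. f m \<in> deg_lt e} = M"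
    using poly_mod_eq_self_iff(2)[OF g_monic] by (auto simp: f_def)
  hence "CARD('a) ^ (e * Suc t) = CARD('a) ^ e * rindex K (smult g ` M)"
    using count[of "deg_lt e"] by (simp add: rindex_M card_deg_lt)
  hence rK: "rindex K (smult g ` M) = CARD('a) ^ (e * t)"
    by (simp add: power_add)
  have "coprime (coeff (H0 + m) 0) g \<longleftrightarrow> f m \<in> T" for m
    using poly_mod_eq_self_iff(2)[OF g_monic] by (simp add: T_def f_def H0(3) coprime_mod_left_iff[OF g])
  hence Yiff: "m \<in> Y \<longleftrightarrow> m \<in> M \<and> coprime (coeff (H0 + m) 0) g" for m by (auto simp: Y_def)
  have "glue_gens = (+) H0 ` Y"
  proof
    show "(+) H0 ` Y \<subseteq> glue_gens"
      using H0 by (auto simp: glue_gens_def Yiff is_ideal_add[OF J] monics_add)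
    show "glue_gens \<subseteq> (+) H0 ` Y"
    proof
      fix H assume H: "H \<in> glue_gens"
      have "H - H0 \<in> Y" unfolding Yiff using H H0(1,2)
        by (auto simp: glue_gens_def is_ideal_diff[OF J] monics_diff)
      thus "H \<in> (+) H0 ` Y" by (metis add.commute diff_add_cancel imageI)
    qed
  qed
  hence "card (glue g J ` glue_gens) = card ((\<lambda>m. glue g J (H0 + m)) ` Y)"
    by (simp add: image_image)
  also have "\<dots> = rindex Y (smult g ` M)"
  proof (rule rindex_eq_card_image[symmetric])
    fix a b assume "a \<in> Y" "b \<in> Y"
    hence "H0 + a \<in> J" "H0 + a \<in> monics (Suc t)" "H0 + b \<in> J" "H0 + b \<in> monics (Suc t)"
      using H0 by (auto simp: Y_def is_ideal_add[OF J] monics_add)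
    from glue_eq_iff[OF this]
    show "glue g J (H0 + a) = glue g J (H0 + b) \<longleftrightarrow> a - b \<in> smult g ` M" by simp
  qed (simp add: subgrp_M smult_image_subgrp)
  also have "\<dots> = card T * rindex K (smult g ` M)"
    unfolding Y_def by (rule count) (auto simp: T_def)
  finally show ?thesis by (simp add: rK T_def mult.commute)
qed

end


section \<open>Counting ideals of the polynomial ring\<close>

text \<open>
  The inner variable of \<open>'a poly poly\<close> is \<open>x\<close>, the outer one \<open>y\<close>. For ideals of finite index, the two
  predicates express that \<open>x\<close> and \<open>y\<close> are invertible modulo \<open>J\<close>.
\<close>
definition x_inv :: "'a::comm_ring_1 poly poly set \<Rightarrow> bool"
  where "x_inv J \<longleftrightarrow> (\<exists>p. [:p:] \<in> J \<and> coeff p 0 \<noteq> 0)"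

definition y_inv :: "'a::comm_ring_1 poly poly set \<Rightarrow> bool"
  where "y_inv J \<longleftrightarrow> (\<exists>F\<in>J. coeff F 0 = 1)"

context field_glueing
begin

text \<open>A polynomial in x alone has degree 0 in y, so \<open>glue_truncation\<close> shows that
  it is divisible by \<open>g\<close>. Conversely \<open>g\<close> times such a polynomial of
  \<open>J\<close> lies in the glued ideal.\<close>

lemma x_inv_glue:
  assumes H: "H \<in> J" "H \<in> monics (Suc t)"
  shows "x_inv (glue g J H) \<longleftrightarrow> coeff g 0 \<noteq> 0 \<and> x_inv J"
proof
  assume "x_inv (glue g J H)"
  then obtain p where p: "[:p:] \<in> glue g J H" "coeff p 0 \<noteq> 0" by (auto simp: x_inv_def)
  have "[:p:] \<in> glue g J H \<inter> deg_lt (Suc t)" using p(1) by (simp add: deg_lt_def coeff_pCons split: nat.splits)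
  then obtain m where m: "[:p:] = smult g m" unfolding glue_truncation[OF H] by blast
  have "coeff [:p:] 0 = coeff (smult g m) 0" by (simp only: m)
  hence "p = g * coeff m 0" by simp
  hence "coeff g 0 \<noteq> 0" using p(2) by (auto simp: coeff_mult)
  moreover have "x_inv J" using p glue_subset[OF H] by (auto simp: x_inv_def)
  ultimately show "coeff g 0 \<noteq> 0 \<and> x_inv J" by blast
next
  assume *: "coeff g 0 \<noteq> 0 \<and> x_inv J"
  then obtain p where p: "[:p:] \<in> J" "coeff p 0 \<noteq> 0" by (auto simp: x_inv_def)
  have "[:g * p:] \<in> glue g J H" using glueI[OF p(1), of g 0 H] by simp
  moreover have "coeff (g * p) 0 \<noteq> 0" using * p(2) by (simp add: coeff_mult)
  ultimately show "x_inv (glue g J H)" by (auto simp: x_inv_def)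
qed

text \<open>Constant coefficients of elements of the glued ideal are combinations of
  \<open>g\<close> and \<open>coeff H 0\<close>; the claim is Bezout's identity for these two, with
  an element of \<open>J\<close> of constant coefficient 1 for the converse.\<close>

lemma y_inv_glue:
  assumes H: "H \<in> J" "H \<in> monics (Suc t)"
  shows "y_inv (glue g J H) \<longleftrightarrow> y_inv J \<and> coprime (coeff H 0) g"
proof
  assume "y_inv (glue g J H)"
  then obtain F where F: "F \<in> glue g J H" "coeff F 0 = 1" by (auto simp: y_inv_def)
  then obtain P K where "F = smult g P + K * H" by (auto simp: glue_def)
  hence "coeff K 0 * coeff H 0 + coeff P 0 * g = 1" using F(2) by (simp add: coeff_mult algebra_simps)
  hence "coprime (coeff H 0) g" unfolding coprime_poly_iff_bezout by blast
  thus "y_inv J \<and> coprime (coeff H 0) g" using F glue_subset[OF H] by (auto simp: y_inv_def)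
next
  assume *: "y_inv J \<and> coprime (coeff H 0) g"
  then obtain u v where uv: "u * coeff H 0 + v * g = 1" unfolding coprime_poly_iff_bezout by blast
  obtain F where F: "F \<in> J" "coeff F 0 = 1" using * by (auto simp: y_inv_def)
  have "smult g (smult v F) + [:u:] * H \<in> glue g J H" by (intro glueI smult_in_J F)
  moreover have "coeff (smult g (smult v F) + [:u:] * H) 0 = 1"
    using uv F(2) by (simp add: algebra_simps)
  ultimately show "y_inv (glue g J H)" unfolding y_inv_def by blast
qed

end

text \<open>The codimension \<open>n\<close> is expressed by the index q^n. The parameter
  \<open>t\<close> is there for the recursion; for \<open>t = n\<close> the monic element exists
  automatically by \<open>monic_of_idx\<close>.\<close>

definition ideals_of :: "'a::{field, finite} itself \<Rightarrow> nat \<Rightarrow> nat \<Rightarrow> 'a poly poly set set"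
  where "ideals_of _ t n = {J. is_ideal J \<and> (\<exists>H\<in>J. H \<in> monics t) \<and> x_inv J \<and> y_inv J \<and> idx J = CARD('a) ^ n}"

definition monics_nz :: "nat \<Rightarrow> 'a::comm_ring_1 poly set"
  where "monics_nz e = {g \<in> monics e. coeff g 0 \<noteq> 0}"

text \<open>For nonzero \<open>g\<close> its cardinality is the Euler function of \<open>g\<close>.
  For \<open>g = 1\<close> the single residue 0 counts, giving the value 1.\<close>

definition coprime_residues :: "'a::field poly \<Rightarrow> 'a poly set"
  where "coprime_residues g = {u \<in> deg_lt (degree g). coprime u g}"

lemma finite_deg_lt: "finite (deg_lt k :: 'a::{zero, finite} poly set)"
  by (rule card_ge_0_finite) (simp add: card_deg_lt)

lemma CARD_field_gt_1: "CARD('a::{field, finite}) > 1"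
  using card_mono[of UNIV "{0, 1::'a}"] by simp

lemma finite_monics_nz: "finite (monics_nz e :: 'a::{comm_ring_1, finite} poly set)"
  by (rule finite_subset[OF _ finite_deg_lt[of "Suc e"]]) (auto simp: monics_nz_def monics_def)

text \<open>Positivity is used to infer that the sets of glued ideals are finite. The witness is
  reduced modulo \<open>g\<close> since 1 itself is no residue when \<open>g\<close> is
  constant.\<close>

lemma card_coprime_residues_pos: "card (coprime_residues (g :: 'a::{field, finite} poly)) > 0" if "g \<noteq> 0"
proof -
  have "finite (coprime_residues g)"
    by (rule finite_subset[OF _ finite_deg_lt[of "degree g"]]) (auto simp: coprime_residues_def)
  moreover have "1 mod g \<in> coprime_residues g"
    using degree_mod_less[OF that, of 1] that by (auto simp: coprime_residues_def deg_lt_iff coprime_mod_left_iff)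
  ultimately show ?thesis by (auto simp: card_gt_0_iff)
qed

text \<open>The only monic polynomial of degree 0 is 1, which forces the unit ideal.\<close>

lemma ideals_of_0: "ideals_of TYPE('a::{field, finite}) 0 n = (if n = 0 then {UNIV} else {})"
proof -
  have "J = UNIV" if J: "is_ideal J" "H \<in> J" "H \<in> monics 0" for J and H :: "'a poly poly"
  proof -
    have "degree H = 0" "lead_coeff H = 1" using J(3) unfolding monics_iff by blast+
    hence "H = 1" by (metis degree_eq_zeroE lead_coeff_pCons(2) one_pCons)
    thus "J = UNIV" using is_ideal_mult[OF J(1,2)] by auto
  qed
  moreover have "rcoset UNIV a = UNIV" for a :: "'a poly poly" by (auto simp: rcoset_def)
  hence "idx (UNIV :: 'a poly poly set) = 1" by (simp add: rindex_def image_constant_conv)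
  moreover have "1 = CARD('a) ^ n \<longleftrightarrow> n = 0"
    using CARD_field_gt_1[where 'a = 'a] power_inject_exp[of "CARD('a)" 0 n] by auto
  moreover have "1 \<in> (monics 0 :: 'a poly poly set)" by (simp add: monics_iff)
  moreover have "x_inv (UNIV :: 'a poly poly set)" "y_inv (UNIV :: 'a poly poly set)"
    unfolding x_inv_def y_inv_def by (intro exI[of _ 1], simp) (rule bexI[of _ 1], simp_all)
  moreover have "is_ideal (UNIV :: 'a poly poly set)" by (simp add: is_ideal_def)
  ultimately have "J \<in> ideals_of TYPE('a) 0 n \<longleftrightarrow> J = UNIV \<and> n = 0" for J
    unfolding ideals_of_def by (cases "J = UNIV") auto
  thus ?thesis by auto
qed

text \<open>Each ideal arises from exactly one triple \<open>(e, g, J)\<close>: existence is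
  \<open>glue_decomposition\<close>, uniqueness is \<open>glue_leading\<close> and
  \<open>glue_colon\<close>. The case \<open>e = 0\<close> means \<open>g = 1\<close>, where gluing
  returns \<open>J\<close> itself.\<close>

lemma ideals_of_Suc:
  fixes t n
  defines "I \<equiv> SIGMA e:{e. Suc t * e \<le> n}. monics_nz e \<times> ideals_of TYPE('a::{field, finite}) t (n - Suc t * e)"
  shows "ideals_of TYPE('a) (Suc t) n = (\<Union>(e, g, J)\<in>I. glue g J ` field_glueing.glue_gens g J t)"
    and "\<And>e g J e' g' J'. (e, g, J) \<in> I \<Longrightarrow> (e', g', J') \<in> I \<Longrightarrow>
      glue g J ` field_glueing.glue_gens g J t \<inter> glue g' J' ` field_glueing.glue_gens g' J' t \<noteq> {} \<Longrightarrow>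
      (e, g, J) = (e', g', J')"
    and "\<And>e g J. (e, g, J) \<in> I \<Longrightarrow> card (glue g J ` field_glueing.glue_gens g J t) =
      CARD('a) ^ (e * t) * card (coprime_residues g)"
proof -
  note q = CARD_field_gt_1[where 'a = 'a]
  have loc: "field_glueing g J t e" if "(e, g, J) \<in> I" for e g J
  proof
    show "g \<noteq> 0" "is_ideal J" "\<exists>h\<in>J. h \<in> monics t" "g \<in> monics e" "idx J > 0"
      using that q by (auto simp: I_def monics_nz_def ideals_of_def monics_iff)
  qed
  have gens: "H \<in> field_glueing.glue_gens g J t \<longleftrightarrow> H \<in> J \<and> H \<in> monics (Suc t) \<and> coprime (coeff H 0) g"
    if "(e, g, J) \<in> I" for e g J H
    by (auto simp: field_glueing.glue_gens_def[OF loc[OF that]])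
  show "ideals_of TYPE('a) (Suc t) n = (\<Union>(e, g, J)\<in>I. glue g J ` field_glueing.glue_gens g J t)"
  proof (intro equalityI subsetI)
    fix J assume "J \<in> ideals_of TYPE('a) (Suc t) n"
    hence J: "is_ideal J" "x_inv J" "y_inv J" "idx J = CARD('a) ^ n" "\<exists>H\<in>J. H \<in> monics (Suc t)"
      by (auto simp: ideals_of_def)
    then obtain H where H: "H \<in> J" "H \<in> monics (Suc t)" by blast
    obtain g where g: "lead_coeff g = 1" "\<And>c. (\<exists>F\<in>J \<inter> deg_lt (Suc t). coeff F t = c) \<longleftrightarrow> g dvd c"
      using ideal_leading_generator[OF J(1), of t] q J(4) by auto
    hence g0: "g \<noteq> 0" by auto
    define J' where "J' = {F. smult g F \<in> J}"
    note dec = glue_decomposition[OF J(1) H g(2) g0, folded J'_def]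
    define e where "e = degree g"
    have "idx J = idx J' * rindex J' J"
      by (rule rindex_mult) (use dec(1,2) J(1) in \<open>simp_all add: subgrp_UNIV is_ideal_subgrp\<close>)
    \<comment> \<open>The index of J' is a factor of the nonzero number q^n, hence finite.\<close>
    hence idx': "idx J' > 0" using J(4) q by (metis gr_zeroI mult_is_0 not_one_less_zero power_eq_0_iff)
    note xyJ = J(2,3) and idxJ = J(4)
    interpret field_glueing g J' t e
      by standard (use dec g0 idx' g(1) in \<open>auto simp: e_def monics_iff\<close>)
    have H': "H \<in> J'" using dec(2) H(1) by blast
    have inv: "coeff g 0 \<noteq> 0" "x_inv J'" "y_inv J'" "coprime (coeff H 0) g"
      using x_inv_glue[OF H' H(2)] y_inv_glue[OF H' H(2)] xyJ dec(4) by simp_all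
    have idx: "CARD('a) ^ n = CARD('a) ^ (e * Suc t) * idx J'"
      using idx_glue[OF H' H(2)] idxJ dec(4) by simp
    \<comment> \<open>Needed before the truncated subtraction \<open>n - Suc t * e\<close> can be
      trusted; it follows as the cofactor \<open>idx J'\<close> is positive.\<close>
    have "Suc t * e \<le> n"
    proof (rule ccontr)
      assume "\<not> Suc t * e \<le> n"
      hence "CARD('a) ^ n < CARD('a) ^ (e * Suc t)" using q by (simp only: power_strict_increasing_iff) (simp add: mult.commute)
      also have "\<dots> \<le> CARD('a) ^ n" using idx idx' by simp
      finally show False by simp
    qed
    moreover from this have "CARD('a) ^ n = CARD('a) ^ (e * Suc t) * CARD('a) ^ (n - Suc t * e)"
      by (simp only: power_add[symmetric]) (simp add: mult.commute)
    hence "CARD('a) ^ (e * Suc t) * idx J' = CARD('a) ^ (e * Suc t) * CARD('a) ^ (n - Suc t * e)"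
      using idx by (rule trans[OF sym, rotated])
    hence "idx J' = CARD('a) ^ (n - Suc t * e)" using q by simp
    ultimately have "(e, g, J') \<in> I"
      using inv dec(1,3) g_monic by (simp add: I_def monics_nz_def ideals_of_def)
    moreover have "H \<in> glue_gens" using inv H' H(2) by (simp add: glue_gens_def)
    ultimately have "glue g J' H \<in> (\<Union>(e, g, J)\<in>I. glue g J ` field_glueing.glue_gens g J t)"
      by blast
    thus "J \<in> (\<Union>(e, g, J)\<in>I. glue g J ` field_glueing.glue_gens g J t)"
      using dec(4) by simp
  next
    fix L assume "L \<in> (\<Union>(e, g, J)\<in>I. glue g J ` field_glueing.glue_gens g J t)"
    then obtain e g J H where I: "(e, g, J) \<in> I" and L: "L = glue g J H" "H \<in> field_glueing.glue_gens g J t"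
      by blast
    interpret field_glueing g J t e using loc[OF I] .
    have H: "H \<in> J" "H \<in> monics (Suc t)" "coprime (coeff H 0) g" using L(2) gens[OF I] by auto
    have e: "Suc t * e \<le> n" and J': "x_inv J" "y_inv J" "idx J = CARD('a) ^ (n - Suc t * e)" "coeff g 0 \<noteq> 0"
      using I by (auto simp: I_def ideals_of_def monics_nz_def)
    have "idx L = CARD('a) ^ (e * Suc t + (n - Suc t * e))"
      unfolding L(1) idx_glue[OF H(1,2)] J'(3) by (simp only: power_add)
    also have "e * Suc t + (n - Suc t * e) = n" using e by (simp only: mult.commute[of e] le_add_diff_inverse)
    finally show "L \<in> ideals_of TYPE('a) (Suc t) n"
      using is_ideal_glue[OF J] H_in_glue[OF H(1,2)] H x_inv_glue[OF H(1,2)] y_inv_glue[OF H(1,2)] J' L(1)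
      by (auto simp: ideals_of_def)
  qed
  show "card (glue g J ` field_glueing.glue_gens g J t) = CARD('a) ^ (e * t) * card (coprime_residues g)"
    if "(e, g, J) \<in> I" for e g J
  proof -
    interpret field_glueing g J t e using loc[OF that] .
    have "degree g = e" using g_monic by (simp add: monics_iff)
    thus ?thesis using card_glue_gens that
      by (auto simp: I_def ideals_of_def y_inv_def coprime_residues_def)
  qed
  fix e g J e' g' J' assume i: "(e, g, J) \<in> I" "(e', g', J') \<in> I"
  assume "glue g J ` field_glueing.glue_gens g J t \<inter> glue g' J' ` field_glueing.glue_gens g' J' t \<noteq> {}"
  then obtain H H' where eq: "glue g J H = glue g' J' H'"
    and H: "H \<in> J" "H \<in> monics (Suc t)" and H': "H' \<in> J'" "H' \<in> monics (Suc t)"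
    using gens[OF i(1)] gens[OF i(2)] by blast
  interpret A: field_glueing g J t e using loc[OF i(1)] .
  interpret B: field_glueing g' J' t e' using loc[OF i(2)] .
  have dv: "g dvd c \<longleftrightarrow> g' dvd c" for c
    using A.glue_leading[OF H, of c] B.glue_leading[OF H', of c] eq by simp
  have lc: "lead_coeff g = 1 \<and> degree g = e" "lead_coeff g' = 1 \<and> degree g' = e'"
    using A.g_monic B.g_monic unfolding monics_iff by blast+
  have "g dvd g'" "g' dvd g" using dv[of g] dv[of g'] by simp_all
  hence g: "g = g'" using lc by (blast intro: monic_dvd_antisym)
  moreover have "J = J'" using A.glue_colon[OF H] B.glue_colon[OF H'] eq g by simp
  moreover have "e = e'" using g lc by simp
  ultimately show "(e, g, J) = (e', g', J')" by simp
qed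

definition coprime_count :: "'a::{field, finite} itself \<Rightarrow> nat \<Rightarrow> nat"
  where "coprime_count _ e = (\<Sum>g\<in>(monics_nz e :: 'a poly set). card (coprime_residues g))"

lemma finite_multiples_le: "finite {e. Suc t * e \<le> n}"
  by (rule finite_subset[of _ "{..n}"]) auto

lemma card_ideals_of_Suc:
  assumes "\<And>n. finite (ideals_of TYPE('a::{field, finite}) t n)"
  shows "finite (ideals_of TYPE('a) (Suc t) n)"
    and "card (ideals_of TYPE('a) (Suc t) n) =
      (\<Sum>e | Suc t * e \<le> n. CARD('a) ^ (e * t) * coprime_count TYPE('a) e * card (ideals_of TYPE('a) t (n - Suc t * e)))"
proof -
  define I where "I = (SIGMA e:{e. Suc t * e \<le> n}. (monics_nz e :: 'a poly set) \<times> ideals_of TYPE('a) t (n - Suc t * e))"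
  define Z where "Z = (\<lambda>(e :: nat, g :: 'a poly, J). glue g J ` field_glueing.glue_gens g J t)"
  note rec = ideals_of_Suc[where 'a = 'a and t = t and n = n, folded I_def]
  have U: "ideals_of TYPE('a) (Suc t) n = (\<Union>i\<in>I. Z i)"
    unfolding rec(1) Z_def ..
  have I: "finite I" unfolding I_def
    by (intro finite_SigmaI finite_multiples_le finite_monics_nz assms)
  have cardZ: "card (Z (e, g, J)) = CARD('a) ^ (e * t) * card (coprime_residues g)" if "(e, g, J) \<in> I" for e g J
    using rec(3)[OF that] by (simp add: Z_def)
  have Zfin: "finite (Z i)" if i: "i \<in> I" for i
  proof (cases i)
    case (fields e g J)
    have "g \<noteq> 0" using i by (auto simp: fields I_def monics_nz_def monics_iff)
    hence "card (Z i) > 0"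
      using i cardZ card_coprime_residues_pos[of g] by (auto simp: fields)
    thus ?thesis by (rule card_ge_0_finite)
  qed
  show "finite (ideals_of TYPE('a) (Suc t) n)" unfolding U using I Zfin by blast
  have "card (ideals_of TYPE('a) (Suc t) n) = (\<Sum>i\<in>I. card (Z i))"
    unfolding U
  proof (rule card_UN_disjoint[OF I])
    show "\<forall>i\<in>I. finite (Z i)" using Zfin by blast
    show "\<forall>i\<in>I. \<forall>j\<in>I. i \<noteq> j \<longrightarrow> Z i \<inter> Z j = {}"
    proof (intro ballI impI)
      fix i j assume ij: "i \<in> I" "j \<in> I" "i \<noteq> j"
      obtain e g J where i: "i = (e, g, J)" by (metis prod.exhaust)
      obtain e' g' J' where j: "j = (e', g', J')" by (metis prod.exhaust)
      show "Z i \<inter> Z j = {}"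
        using rec(2)[of e g J e' g' J'] ij by (auto simp: i j Z_def)
    qed
  qed
  also have "\<dots> = (\<Sum>(e, p)\<in>I. CARD('a) ^ (e * t) * card (coprime_residues (fst p)))"
    by (intro sum.cong) (auto simp: cardZ)
  also have "\<dots> = (\<Sum>e | Suc t * e \<le> n. \<Sum>p\<in>(monics_nz e :: 'a poly set) \<times> ideals_of TYPE('a) t (n - Suc t * e).
      CARD('a) ^ (e * t) * card (coprime_residues (fst p)))"
    unfolding I_def
  proof (subst sum.Sigma)
    show "finite {e. Suc t * e \<le> n}" by (rule finite_multiples_le)
    show "\<forall>e\<in>{e. Suc t * e \<le> n}. finite ((monics_nz e :: 'a poly set) \<times> ideals_of TYPE('a) t (n - Suc t * e))"
      by (intro ballI finite_cartesian_product finite_monics_nz assms)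
  qed (rule refl)
  also have "\<dots> = (\<Sum>e | Suc t * e \<le> n. CARD('a) ^ (e * t) * coprime_count TYPE('a) e * card (ideals_of TYPE('a) t (n - Suc t * e)))"
    by (intro sum.cong refl)
      (simp add: sum.cartesian_product' coprime_count_def sum_distrib_left mult_ac)
  finally show "card (ideals_of TYPE('a) (Suc t) n) = \<dots>" .
qed

lemma finite_ideals_of: "finite (ideals_of TYPE('a::{field, finite}) t n)"
proof (induction t arbitrary: n)
  case 0
  thus ?case by (simp add: ideals_of_0)
qed (rule card_ideals_of_Suc(1))


section \<open>Counting coprime pairs\<close>

lemma card_monics: "card (monics k :: 'a::{comm_ring_1, finite} poly set) = CARD('a) ^ k"
proof -
  have "monics k = (\<lambda>p. monom 1 k + p) ` (deg_lt k :: 'a poly set)"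
  proof
    have "p \<in> (\<lambda>p. monom 1 k + p) ` deg_lt k" if "p \<in> monics k" for p :: "'a poly"
    proof -
      have "monom 1 k \<in> (monics k :: 'a poly set)" by (auto simp: monics_def deg_lt_def)
      hence "p - monom 1 k \<in> deg_lt k" using that by (intro monics_diff)
      thus ?thesis by (auto intro!: image_eqI[of p _ "p - monom 1 k"])
    qed
    thus "monics k \<subseteq> (\<lambda>p. monom 1 k + p) ` (deg_lt k :: 'a poly set)" by blast
  qed (auto simp: monics_def deg_lt_def)
  thus ?thesis by (simp add: card_image card_deg_lt)
qed

lemma card_monics_nz:
  "card (monics_nz k :: 'a::{field, finite} poly set) = (if k = 0 then 1 else (CARD('a) - 1) * CARD('a) ^ (k - 1))"
proof (cases k)
  case 0
  have "monics_nz 0 = (monics 0 :: 'a poly set)" by (auto simp: monics_nz_def monics_def)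
  thus ?thesis using 0 by (simp add: card_monics)
next
  case (Suc j)
  have "monics_nz (Suc j) = (\<lambda>(c, p). pCons c p) ` ((UNIV - {0 :: 'a}) \<times> monics j)"
  proof
    show "monics_nz (Suc j) \<subseteq> (\<lambda>(c, p). pCons c p) ` ((UNIV - {0 :: 'a}) \<times> monics j)"
    proof
      fix p :: "'a poly" assume p: "p \<in> monics_nz (Suc j)"
      obtain c r where pc: "p = pCons c r" by (cases p)
      have "coeff r i = coeff p (Suc i)" for i by (simp add: pc)
      hence "r \<in> monics j" using p by (auto simp: monics_nz_def monics_def deg_lt_def)
      moreover have "c \<noteq> 0" using p by (simp add: pc monics_nz_def)
      ultimately show "p \<in> (\<lambda>(c, p). pCons c p) ` ((UNIV - {0 :: 'a}) \<times> monics j)" using pc by auto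
    qed
  qed (auto simp: monics_nz_def pCons_monics)
  moreover have "inj_on (\<lambda>(c, p). pCons c p) ((UNIV - {0 :: 'a}) \<times> monics j)"
    by (auto simp: inj_on_def)
  ultimately have "card (monics_nz (Suc j) :: 'a poly set) = card ((UNIV - {0 :: 'a}) \<times> (monics j :: 'a poly set))"
    by (simp add: card_image)
  thus ?thesis using Suc by (simp add: card_cartesian_product card_monics)
qed

lemma monics_nz_iff: "g \<in> monics_nz e \<longleftrightarrow> degree g = e \<and> lead_coeff g = 1 \<and> coeff g 0 \<noteq> 0"
  unfolding monics_nz_def by (simp only: mem_Collect_eq monics_iff conj_assoc)

text \<open>Splitting off the greatest common divisor of a pair \<open>(g, u)\<close> leaves a coprime pair.\<close>
lemma sum_coprime_count:
  "(\<Sum>k\<le>e. card (monics_nz k :: 'a::{field, finite} poly set) * coprime_count TYPE('a) (e - k)) =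
    card (monics_nz e :: 'a poly set) * CARD('a) ^ e"
proof -
  define D where "D = (SIGMA k:{..e}. (monics_nz k :: 'a poly set) \<times> (SIGMA g:(monics_nz (e - k) :: 'a poly set). coprime_residues g))"
  define \<phi> where "\<phi> = (\<lambda>(k :: nat, d :: 'a poly, g, u). (d * g, d * u))"
  have fin: "finite (coprime_residues g)" for g :: "'a poly"
    by (rule finite_subset[OF _ finite_deg_lt[of "degree g"]]) (auto simp: coprime_residues_def)
  have "inj_on \<phi> D"
  proof (rule inj_onI)
    fix x y assume xy: "x \<in> D" "y \<in> D" "\<phi> x = \<phi> y"
    obtain k d g u where x: "x = (k, d, g, u)" by (metis prod.exhaust)
    obtain k' d' g' u' where y: "y = (k', d', g', u')" by (metis prod.exhaust)
    have "d \<in> monics_nz k" "d' \<in> monics_nz k'" and cop: "coprime u g" "coprime u' g'"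
      using xy(1,2) by (auto simp: x y D_def coprime_residues_def)
    hence d: "degree d = k" "lead_coeff d = 1" "degree d' = k'" "lead_coeff d' = 1"
      unfolding monics_nz_iff by blast+
    have eq: "d * g = d' * g'" "d * u = d' * u'" using xy(3) by (simp_all add: x y \<phi>_def)
    \<comment> \<open>By Bezout, \<open>d\<close> is a combination of \<open>d * g\<close> and
      \<open>d * u\<close>, hence divisible by every common divisor of the pair. By symmetry the two
      monic divisors agree.\<close>
    have dvd: "d' dvd d" if "coprime u g" "d * g = d' * g'" "d * u = d' * u'" for d g u d' g' u' :: "'a poly"
    proof -
      obtain a b where "a * u + b * g = 1" using \<open>coprime u g\<close> coprime_poly_iff_bezout by blast
      hence "d = d * (a * u + b * g)" by simp
      also have "\<dots> = a * (d * u) + b * (d * g)" by (simp add: algebra_simps)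
      also have "\<dots> = d' * (a * u' + b * g')" using that by (simp add: algebra_simps)
      finally show ?thesis by (rule dvdI)
    qed
    have "d' dvd d" "d dvd d'" using dvd[OF cop(1) eq] dvd[OF cop(2) eq[symmetric]] by blast+
    hence dd: "d = d'" using d by (blast intro: monic_dvd_antisym)
    have "d \<noteq> 0" using d(2) by auto
    with dd eq d show "x = y" by (simp add: x y)
  qed
  moreover have "\<phi> ` D = monics_nz e \<times> deg_lt e"
  proof (intro equalityI subsetI)
    fix z assume "z \<in> \<phi> ` D"
    then obtain k d g u where z: "z = (d * g, d * u)" and k: "k \<le> e"
      and "d \<in> monics_nz k" "g \<in> monics_nz (e - k)" and u: "u \<in> deg_lt (degree g)"
      by (auto simp: D_def \<phi>_def coprime_residues_def)
    hence d: "degree d = k" "lead_coeff d = 1" "coeff d 0 \<noteq> 0"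
      and g: "degree g = e - k" "lead_coeff g = 1" "coeff g 0 \<noteq> 0"
      unfolding monics_nz_iff by blast+
    have "d \<noteq> 0" "g \<noteq> 0" using d g by auto
    hence "degree (d * g) = e" using d(1) g(1) k by (simp add: degree_mult_eq)
    moreover have "lead_coeff (d * g) = 1" by (simp only: lead_coeff_mult d(2) g(2)) simp
    ultimately have "d * g \<in> monics_nz e" using d(3) g(3) by (simp add: monics_nz_iff coeff_mult)
    moreover have "d * u \<in> deg_lt e"
      using u g(1) d(1) k \<open>d \<noteq> 0\<close> by (cases "u = 0") (auto simp: deg_lt_iff degree_mult_eq)
    ultimately show "z \<in> monics_nz e \<times> deg_lt e" by (simp add: z)
  next
    fix z :: "'a poly \<times> 'a poly" assume "z \<in> monics_nz e \<times> deg_lt e"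
    then obtain G U where z: "z = (G, U)" and "G \<in> monics_nz e" and U: "U \<in> deg_lt e"
      by blast
    hence G: "degree G = e" "lead_coeff G = 1" "coeff G 0 \<noteq> 0"
      unfolding monics_nz_iff by blast+
    have "G \<noteq> 0" using G by auto
    then obtain d a b where d: "lead_coeff d = 1" "d dvd G" "d dvd U" "d = a * G + b * U"
      using poly_monic_gcd_bezout by blast
    obtain g where g: "G = d * g" using d(2) by (rule dvdE)
    obtain u where u: "U = d * u" using d(3) by (rule dvdE)
    have nz: "d \<noteq> 0" "g \<noteq> 0" using \<open>G \<noteq> 0\<close> g by auto
    have "d * (b * u + a * g) = d * 1" using d(4) by (simp add: g u algebra_simps)
    hence "b * u + a * g = 1" using nz(1) by simp
    hence cop: "coprime u g" using coprime_poly_iff_bezout by blast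
    have deg: "e = degree d + degree g" using G(1) g nz by (simp add: degree_mult_eq)
    have "lead_coeff g = 1" using G(2) d(1) unfolding g lead_coeff_mult by simp
    moreover have "coeff d 0 \<noteq> 0" "coeff g 0 \<noteq> 0" using G(3) by (auto simp: g coeff_mult)
    moreover have "u \<in> deg_lt (degree g)" using U nz deg
      by (cases "u = 0") (auto simp: u deg_lt_iff degree_mult_eq)
    ultimately have "(degree d, d, g, u) \<in> D"
      using d(1) cop deg unfolding D_def coprime_residues_def by (simp add: monics_nz_iff)
    moreover have "\<phi> (degree d, d, g, u) = z" by (simp add: \<phi>_def z g u)
    ultimately show "z \<in> \<phi> ` D" by (metis imageI)
  qed
  ultimately have "card D = card (monics_nz e :: 'a poly set) * CARD('a) ^ e"
    using card_image[of \<phi> D] by (simp add: card_cartesian_product card_deg_lt)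
  moreover have "card D = (\<Sum>k\<le>e. card (monics_nz k :: 'a poly set) * coprime_count TYPE('a) (e - k))"
    unfolding D_def coprime_count_def
    by (simp add: card_SigmaI card_cartesian_product finite_SigmaI finite_monics_nz fin)
  ultimately show ?thesis by simp
qed

lemma coprime_count_0: "coprime_count TYPE('a::{field, finite}) 0 = 1"
  using sum_coprime_count[where 'a = 'a and e = 0] by (simp add: card_monics_nz)

text \<open>The numbers \<open>D k\<close> have generating function (1 - z) / (1 - q z). Multiplying
  the convolution \<open>T\<close> of \<open>D\<close> and \<open>S\<close> by 1 - q z therefore
  leaves (1 - z) times the series of \<open>S\<close>, which is \<open>step\<close>; summing the
  increments gives the formula.\<close>

lemma coprime_count_Suc:
  "int (coprime_count TYPE('a::{field, finite}) (Suc e)) = (int CARD('a) - 1)\<^sup>2 * (\<Sum>j\<le>e. int CARD('a) ^ (2 * j))"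
proof -
  define q where "q = int CARD('a)"
  define S where "S e = int (coprime_count TYPE('a) e)" for e
  define D where "D k = int (card (monics_nz k :: 'a poly set))" for k
  define T where "T e = (\<Sum>k\<le>e. D k * S (e - k))" for e
  have q1: "int (CARD('a) - 1) = q - 1" using CARD_field_gt_1[where 'a = 'a] by (simp add: q_def of_nat_diff)
  have D: "D 0 = 1" "D (Suc k) = (q - 1) * q ^ k" for k
    unfolding D_def by (simp_all add: card_monics_nz q1) (simp add: q_def)
  have Tq: "T e = D e * q ^ e" for e
    using arg_cong[OF sum_coprime_count[where 'a = 'a and e = e], of int]
    by (simp add: T_def D_def S_def q_def)
  have step: "S (Suc e) = S e + (T (Suc e) - q * T e)" for e
  proof -
    \<comment> \<open>The correction at \<open>k = 0\<close> reflects \<open>D 0 = 1\<close> and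
      \<open>D 1 = q - 1\<close>; from there on \<open>D\<close> is geometric.\<close>
    have DS: "D (Suc k) = q * D k - (if k = 0 then 1 else 0)" for k
      by (cases k) (simp_all add: D)
    have "T (Suc e) = D 0 * S (Suc e) + (\<Sum>k\<le>e. D (Suc k) * S (e - k))"
      unfolding T_def by (subst sum.atMost_Suc_shift) simp
    also have "(\<Sum>k\<le>e. D (Suc k) * S (e - k)) = q * T e - (\<Sum>k\<le>e. if k = 0 then S e else 0)"
      unfolding T_def sum_distrib_left sum_subtractf[symmetric]
      by (intro sum.cong) (auto simp: DS algebra_simps)
    also have "(\<Sum>k\<le>e. if k = 0 then S e else 0) = S e" by simp
    finally show ?thesis by (simp add: D)
  qed
  have "S (Suc e) = (q - 1)\<^sup>2 * (\<Sum>j\<le>e. q ^ (2 * j))"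
  proof (induction e)
    case 0
    have "S 0 = 1" by (simp add: S_def coprime_count_0)
    thus ?case unfolding step by (simp add: Tq D power2_eq_square algebra_simps)
  next
    case (Suc e)
    have "T (Suc (Suc e)) - q * T (Suc e) = (q - 1)\<^sup>2 * q ^ (2 * Suc e)"
    proof -
      have "q ^ (2 * Suc e) = q ^ Suc e * q ^ Suc e" by (simp only: mult_2 power_add)
      thus ?thesis by (simp only: Tq D power_Suc) (simp add: power2_eq_square algebra_simps)
    qed
    thus ?case unfolding step[of "Suc e"] Suc by (simp add: distrib_left)
  qed
  thus ?thesis by (simp add: S_def q_def)
qed


section \<open>Localization\<close>

text \<open>With finitely many cosets, two powers of \<open>s\<close> agree modulo \<open>I\<close>.
  Once \<open>s ^ i\<close> can be cancelled, \<open>s ^ k\<close> is an inverse of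
  \<open>s\<close>.\<close>

lemma unit_power_collision:
  assumes I: "is_ideal I" "idx I > 0"
  shows "\<exists>i k. s ^ i * (s ^ Suc k - 1) \<in> I"
proof -
  define f where "f n = rcoset I (s ^ n)" for n :: nat
  have "range f \<subseteq> rcoset I ` UNIV" by (auto simp: f_def)
  moreover have "finite (rcoset I ` UNIV)" using I(2) by (intro card_ge_0_finite) (simp add: rindex_def)
  ultimately have "finite (range f)" by (rule finite_subset)
  hence "\<not> inj f" using finite_imageD[of f UNIV] infinite_UNIV_nat by blast
  then obtain m n where "m < n" "f n = f m" unfolding inj_def by (metis linorder_less_linear)
  then obtain k where k: "n = m + Suc k" using less_imp_Suc_add by fastforce
  have "s ^ n - s ^ m \<in> I" using \<open>f n = f m\<close> rcoset_eq_iff[OF is_ideal_subgrp[OF I(1)]] by (simp add: f_def)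
  also have "s ^ n - s ^ m = s ^ m * (s ^ Suc k - 1)" by (simp add: k power_add right_diff_distrib)
  finally show ?thesis by blast
qed

text \<open>\<open>\<iota>\<close> is the localization at the powers of \<open>s\<close>, and
  \<open>r\<close> is the inverse of \<open>s\<close> in the larger ring.\<close>

locale ring_localization =
  fixes \<iota> :: "'a::comm_ring_1 \<Rightarrow> 'b::comm_ring_1" and s :: 'a and r :: 'b
  assumes add: "\<iota> (a + b) = \<iota> a + \<iota> b" and mult: "\<iota> (a * b) = \<iota> a * \<iota> b" and one: "\<iota> 1 = 1"
    and inj: "\<iota> a = \<iota> b \<Longrightarrow> a = b"
    and inv: "r * \<iota> s = 1"
    and frac: "\<exists>m a. \<iota> s ^ m * z = \<iota> a"
begin

lemma zero: "\<iota> 0 = 0" using add[of 0 0] by simp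
lemma diff: "\<iota> (a - b) = \<iota> a - \<iota> b" using add[of "a - b" b] by simp
lemma power: "\<iota> (a ^ n) = \<iota> a ^ n" by (induction n) (simp_all add: one mult)

lemma ideal_cancel_s:
  assumes J: "is_ideal J"
  shows "\<iota> s ^ m * z \<in> J \<longleftrightarrow> z \<in> J"
proof
  assume "\<iota> s ^ m * z \<in> J"
  hence "r ^ m * (\<iota> s ^ m * z) \<in> J" by (rule is_ideal_mult[OF J])
  moreover have "r ^ m * (\<iota> s ^ m * z) = (r * \<iota> s) ^ m * z" by (simp only: power_mult_distrib mult.assoc)
  ultimately show "z \<in> J" by (simp add: inv)
qed (rule is_ideal_mult[OF J])

lemma is_ideal_vimage: "is_ideal J \<Longrightarrow> is_ideal (\<iota> -` J)"
  unfolding is_ideal_def by (simp add: zero add mult)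

lemma vimage_subset_imp_subset:
  assumes "is_ideal J" "is_ideal J'" "\<iota> -` J \<subseteq> \<iota> -` J'"
  shows "J \<subseteq> J'"
proof
  fix z assume z: "z \<in> J"
  obtain m a where ma: "\<iota> s ^ m * z = \<iota> a" using frac by blast
  hence "\<iota> a \<in> J" using z ideal_cancel_s[OF assms(1)] by metis
  hence "\<iota> a \<in> J'" using assms(3) by blast
  thus "z \<in> J'" using ma ideal_cancel_s[OF assms(2)] by metis
qed

text \<open>The quotient by the preimage embeds into the quotient by \<open>J\<close>. If the former
  is finite, \<open>s\<close> is already invertible in it, so every fraction is congruent to an
  element of the smaller ring and the embedding is onto.\<close>

lemma idx_vimage:
  assumes J: "is_ideal J"
  shows "idx J > 0 \<Longrightarrow> idx (\<iota> -` J) > 0"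
    and "idx (\<iota> -` J) > 0 \<Longrightarrow> idx J = idx (\<iota> -` J) \<and> (\<exists>u. s * u - 1 \<in> \<iota> -` J)"
proof -
  let ?I = "\<iota> -` J"
  note I = is_ideal_vimage[OF J]
  note sg = is_ideal_subgrp[OF J] is_ideal_subgrp[OF I]
  have idxI: "idx ?I = card ((\<lambda>a. rcoset J (\<iota> a)) ` UNIV)"
    by (rule rindex_eq_card_image) (simp_all add: sg rcoset_eq_iff diff)
  have sub: "(\<lambda>a. rcoset J (\<iota> a)) ` UNIV \<subseteq> rcoset J ` UNIV" by blast
  show "idx ?I > 0" if "idx J > 0"
  proof -
    have "finite (rcoset J ` UNIV)" using that by (intro card_ge_0_finite) (simp add: rindex_def)
    thus ?thesis unfolding idxI using finite_subset[OF sub] by (simp add: card_gt_0_iff)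
  qed
  assume pos: "idx ?I > 0"
  obtain i k where "s ^ i * (s ^ Suc k - 1) \<in> ?I" using unit_power_collision[OF I pos] by blast
  hence "\<iota> s ^ i * \<iota> (s ^ Suc k - 1) \<in> J" by (simp add: mult power)
  hence "\<iota> (s ^ Suc k - 1) \<in> J" using ideal_cancel_s[OF J] by blast
  hence u: "s * s ^ k - 1 \<in> ?I" by simp
  have "rcoset J ` UNIV \<subseteq> (\<lambda>a. rcoset J (\<iota> a)) ` UNIV"
  proof clarify
    fix z
    obtain m a where ma: "\<iota> s ^ m * z = \<iota> a" using frac by blast
    \<comment> \<open>\<open>s ^ k\<close> inverts \<open>s\<close> modulo the preimage, so
      \<open>v\<close> inverts \<open>s ^ m\<close>, and \<open>v * a\<close> represents the class
      of \<open>z\<close>.\<close>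
    define v where "v = (s ^ k) ^ m"
    have v: "s ^ m * v - 1 \<in> ?I"
    proof -
      have "s ^ m * v - 1 = (s * s ^ k) ^ m - 1" by (simp add: v_def power_mult_distrib)
      also have "\<dots> = (\<Sum>i<m. (s * s ^ k) ^ i) * (s * s ^ k - 1)"
        by (subst power_diff_1_eq) (simp add: mult.commute)
      also have "\<dots> \<in> ?I" by (rule is_ideal_mult[OF I u])
      finally show ?thesis .
    qed
    have "\<iota> s ^ m * (\<iota> (v * a) - z) = \<iota> a * \<iota> (s ^ m * v - 1)"
      by (simp only: right_diff_distrib ma mult diff one power) (simp add: mult_ac)
    also have "\<dots> \<in> J" using is_ideal_mult[OF J] v by simp
    finally have "\<iota> (v * a) - z \<in> J" using ideal_cancel_s[OF J] by blast
    hence "rcoset J z = rcoset J (\<iota> (v * a))" using rcoset_eq_iff[OF sg(1)] by metis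
    thus "rcoset J z \<in> (\<lambda>a. rcoset J (\<iota> a)) ` UNIV" by blast
  qed
  hence "idx J = idx ?I" unfolding idxI using sub by (simp add: rindex_def subset_antisym)
  thus "idx J = idx ?I \<and> (\<exists>u. s * u - 1 \<in> ?I)" using u by blast
qed

text \<open>Contraction of ideals is inverted by extension. Positivity of \<open>N\<close> excludes
  infinite index, whose value is 0.\<close>

lemma bij_betw_vimage_ideals:
  assumes "N > 0"
  shows "bij_betw (vimage \<iota>) {J. is_ideal J \<and> idx J = N} {I. is_ideal I \<and> idx I = N \<and> (\<exists>u. s * u - 1 \<in> I)}"
  unfolding bij_betw_def
proof
  show "inj_on (vimage \<iota>) {J. is_ideal J \<and> idx J = N}"
    by (rule inj_onI) (simp add: subset_antisym vimage_subset_imp_subset)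
  show "vimage \<iota> ` {J. is_ideal J \<and> idx J = N} = {I. is_ideal I \<and> idx I = N \<and> (\<exists>u. s * u - 1 \<in> I)}"
  proof (intro equalityI subsetI)
    fix I assume "I \<in> vimage \<iota> ` {J. is_ideal J \<and> idx J = N}"
    then obtain J where J: "is_ideal J" "idx J = N" "I = \<iota> -` J" by blast
    thus "I \<in> {I. is_ideal I \<and> idx I = N \<and> (\<exists>u. s * u - 1 \<in> I)}"
      using idx_vimage[OF J(1)] is_ideal_vimage[OF J(1)] assms by simp
  next
    fix I assume "I \<in> {I. is_ideal I \<and> idx I = N \<and> (\<exists>u. s * u - 1 \<in> I)}"
    then obtain u where I: "is_ideal I" "idx I = N" and u: "s * u - 1 \<in> I" by blast
    \<comment> \<open>The extension of \<open>I\<close>: all elements that some power of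
      \<open>s\<close> moves into the image of \<open>I\<close>.\<close>
    define J where "J = {z. \<exists>m. \<exists>a\<in>I. \<iota> s ^ m * z = \<iota> a}"
    have JI: "z \<in> J" if "\<iota> s ^ m * z = \<iota> a" "a \<in> I" for z m a using that by (auto simp: J_def)
    have "is_ideal J"
      unfolding is_ideal_def
    proof (intro conjI ballI allI)
      show "0 \<in> J" by (rule JI[of 0 _ 0]) (simp_all add: zero is_ideal_0[OF I(1)])
      fix z assume "z \<in> J"
      then obtain m a where z: "\<iota> s ^ m * z = \<iota> a" "a \<in> I" by (auto simp: J_def)
      show "w * z \<in> J" for w
      proof -
        obtain n b where w: "\<iota> s ^ n * w = \<iota> b" using frac by blast
        have "\<iota> s ^ (n + m) * (w * z) = (\<iota> s ^ n * w) * (\<iota> s ^ m * z)" by (simp add: power_add mult_ac)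
        hence "\<iota> s ^ (n + m) * (w * z) = \<iota> (b * a)" by (simp add: w z mult)
        thus ?thesis using is_ideal_mult[OF I(1) z(2)] by (rule JI)
      qed
      fix w assume "w \<in> J"
      then obtain n b where w: "\<iota> s ^ n * w = \<iota> b" "b \<in> I" by (auto simp: J_def)
      have "\<iota> s ^ (n + m) * (z + w) = \<iota> s ^ n * (\<iota> s ^ m * z) + \<iota> s ^ m * (\<iota> s ^ n * w)"
        by (simp add: power_add algebra_simps)
      also have "\<dots> = \<iota> (s ^ n * a + s ^ m * b)" by (simp add: z w mult add power)
      finally show "z + w \<in> J"
        by (rule JI) (intro is_ideal_add[OF I(1)] is_ideal_mult[OF I(1)] z w)
    qed
    moreover have "\<iota> -` J = I"
    proof (intro equalityI subsetI)
      fix a assume "a \<in> I" thus "a \<in> \<iota> -` J" using JI[of 0 "\<iota> a" a] by simp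
    next
      fix b assume "b \<in> \<iota> -` J"
      then obtain m a where "\<iota> s ^ m * \<iota> b = \<iota> a" "a \<in> I" by (auto simp: J_def)
      hence *: "s ^ m * b \<in> I" using inj[of "s ^ m * b" a] by (simp add: mult power)
      \<comment> \<open>Since \<open>u\<close> inverts \<open>s\<close> modulo \<open>I\<close>,
        powers of \<open>s\<close> cancel; this is why contracting the extension returns
        \<open>I\<close>.\<close>
      have "b \<in> I" if "s ^ m * b \<in> I" for m
        using that
      proof (induction m)
        case (Suc m)
        have "s ^ m * b = u * (s ^ Suc m * b) - (s ^ m * b) * (s * u - 1)" by (simp add: algebra_simps)
        also have "\<dots> \<in> I" by (intro is_ideal_diff[OF I(1)] is_ideal_mult[OF I(1)] u Suc.prems)
        finally show ?case by (rule Suc.IH)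
      qed simp
      thus "b \<in> I" using * by blast
    qed
    ultimately show "I \<in> vimage \<iota> ` {J. is_ideal J \<and> idx J = N}"
      using idx_vimage(2)[of J] I(2) assms by (intro image_eqI[of _ _ J]) auto
  qed
qed

end

section \<open>The embedding of k[x, y] into the Laurent polynomials\<close>

definition eval_poly :: "('b::comm_ring_1 \<Rightarrow> 'c::comm_ring_1) \<Rightarrow> 'c \<Rightarrow> 'b poly \<Rightarrow> 'c"
  where "eval_poly f x p = poly (map_poly f p) x"

locale eval_hom =
  fixes f :: "'b::comm_ring_1 \<Rightarrow> 'c::comm_ring_1" and x :: 'c
  assumes f_add: "f (a + b) = f a + f b" and f_mult: "f (a * b) = f a * f b" and f_1: "f 1 = 1"
begin

lemma f_0: "f 0 = 0" using f_add[of 0 0] by simp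

lemma eval_0: "eval_poly f x 0 = 0"
  by (simp add: eval_poly_def)

lemma eval_pCons: "eval_poly f x (pCons a p) = f a + x * eval_poly f x p"
  by (simp add: eval_poly_def map_poly_pCons f_0)

lemma eval_add: "eval_poly f x (p + q) = eval_poly f x p + eval_poly f x q"
  by (induction p q rule: poly_induct2) (simp_all add: eval_0 eval_pCons f_add algebra_simps)

lemma eval_smult: "eval_poly f x (smult a p) = f a * eval_poly f x p"
  by (induction p) (simp_all add: eval_0 eval_pCons f_mult algebra_simps)

lemma eval_mult: "eval_poly f x (p * q) = eval_poly f x p * eval_poly f x q"
  by (induction p) (simp_all add: eval_0 eval_pCons eval_add eval_smult f_0 algebra_simps)

lemma eval_1: "eval_poly f x 1 = 1"
  by (simp add: one_pCons eval_pCons eval_0 f_1)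

end

abbreviation laurent_inner :: "'a::field poly \<Rightarrow> 'a laurent2"
  where "laurent_inner \<equiv> eval_poly (Poly_Mapping.single 0) (Poly_Mapping.single (1, 0) 1)"

abbreviation laurent_emb :: "'a::field poly poly \<Rightarrow> 'a laurent2"
  where "laurent_emb \<equiv> eval_poly laurent_inner (Poly_Mapping.single (0, 1) 1)"

interpretation inner: eval_hom "Poly_Mapping.single 0 :: 'a::field \<Rightarrow> 'a laurent2" "Poly_Mapping.single (1, 0) 1"
  by standard (simp_all add: single_add mult_single)

interpretation emb: eval_hom "laurent_inner :: 'a::field poly \<Rightarrow> 'a laurent2" "Poly_Mapping.single (0, 1) 1"
  by standard (simp_all add: inner.eval_add inner.eval_mult inner.eval_1)

lemma poly_mapping_single_induct [case_names zero add]: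
  assumes "P 0" "\<And>k v f. P f \<Longrightarrow> P (Poly_Mapping.single k v + f)"
  shows "P (f :: 'k \<Rightarrow>\<^sub>0 'v::comm_monoid_add)"
proof (induction f rule: update_induct)
  case const
  thus ?case by (rule assms)
next
  case (update f a b)
  have "Poly_Mapping.update a b f = Poly_Mapping.single a b + f"
    using update.hyps
    by (intro poly_mapping_eqI) (auto simp: lookup_update lookup_add lookup_single in_keys_iff when_def)
  thus ?case using assms(2) update by metis
qed

lemma lookup_single_mult:
  fixes k :: "'k::ab_group_add" and f :: "'k \<Rightarrow>\<^sub>0 'v::comm_semiring_1"
  shows "poly_mapping.lookup (Poly_Mapping.single k 1 * f) z = poly_mapping.lookup f (z - k)"
proof (induction f rule: poly_mapping_single_induct)
  case (add l v f)
  have "k + l = z \<longleftrightarrow> l = z - k" by (auto simp: algebra_simps)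
  thus ?case using add by (simp add: distrib_left lookup_add mult_single lookup_single)
qed simp

lemma lookup_laurent_inner:
  "poly_mapping.lookup (laurent_inner p) (a, b) = (if b = 0 \<and> a \<ge> 0 then coeff p (nat a) else 0)"
proof (induction p arbitrary: a)
  case 0
  thus ?case by (simp add: inner.eval_0)
next
  case (pCons c p)
  have "poly_mapping.lookup (laurent_inner (pCons c p)) (a, b) =
      (c when a = 0 \<and> b = 0) + poly_mapping.lookup (laurent_inner p) (a - 1, b)"
    unfolding inner.eval_pCons lookup_add lookup_single_mult lookup_single
    by (auto simp: when_def zero_prod_def)
  thus ?case
    by (auto simp: pCons.IH when_def coeff_pCons nat_diff_distrib split: nat.splits)
qed

text \<open>This yields injectivity of the embedding. The outer degree is the exponent of y, the
  second component.\<close>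

lemma lookup_laurent_emb:
  "poly_mapping.lookup (laurent_emb F) (a, b) = (if a \<ge> 0 \<and> b \<ge> 0 then coeff (coeff F (nat b)) (nat a) else 0)"
proof (induction F arbitrary: b)
  case 0
  thus ?case by (simp add: emb.eval_0)
next
  case (pCons p F)
  have "poly_mapping.lookup (laurent_emb (pCons p F)) (a, b) =
      poly_mapping.lookup (laurent_inner p) (a, b) + poly_mapping.lookup (laurent_emb F) (a, b - 1)"
    unfolding emb.eval_pCons lookup_add lookup_single_mult by simp
  thus ?case
    by (auto simp: pCons.IH lookup_laurent_inner coeff_pCons nat_diff_distrib split: nat.splits)
qed

lemma laurent_emb_monom:
  "laurent_emb (monom (monom c i) j) = Poly_Mapping.single (int i, int j) c"
  by (rule poly_mapping_eqI)
    (auto simp: lookup_laurent_emb lookup_single when_def Polynomial.coeff_monom split: if_splits)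

text \<open>Inverting this one element inverts both x and y.\<close>

abbreviation xy :: "'a::field poly poly"
  where "xy \<equiv> monom (monom 1 1) 1"

lemma power_single: "Poly_Mapping.single (a, b) (1::'a::field) ^ m = Poly_Mapping.single (int m * a, int m * b) 1"
  by (induction m) (simp_all add: mult_single algebra_simps single_one flip: zero_prod_def)

interpretation laurent: ring_localization "laurent_emb :: 'a::field poly poly \<Rightarrow> 'a laurent2" xy "Poly_Mapping.single (- 1, - 1) 1"
proof
  fix F G :: "'a poly poly"
  show "laurent_emb (F + G) = laurent_emb F + laurent_emb G" by (rule emb.eval_add)
  show "laurent_emb (F * G) = laurent_emb F * laurent_emb G" by (rule emb.eval_mult)
  show "laurent_emb 1 = 1" by (rule emb.eval_1)
  show "Poly_Mapping.single (- 1, - 1) 1 * laurent_emb xy = 1"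
    by (simp add: laurent_emb_monom mult_single flip: zero_prod_def)
  show "F = G" if eq: "laurent_emb F = laurent_emb G"
  proof (intro poly_eqI)
    fix j i
    have "poly_mapping.lookup (laurent_emb F) (int i, int j) = poly_mapping.lookup (laurent_emb G) (int i, int j)" by (simp add: eq)
    thus "coeff (coeff F j) i = coeff (coeff G j) i" by (simp add: lookup_laurent_emb)
  qed
  fix z :: "'a laurent2"
  have s: "laurent_emb xy ^ m = Poly_Mapping.single (int m, int m) (1::'a)" for m
    by (simp add: laurent_emb_monom power_single)
  show "\<exists>m F. laurent_emb xy ^ m * z = laurent_emb F"
  proof (induction z rule: poly_mapping_single_induct)
    case zero
    show ?case by (rule exI[of _ 0], rule exI[of _ 0]) (simp add: emb.eval_0)
  next
    case (add k v z)
    obtain a b where k: "k = (a, b)" by (cases k)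
    obtain m F where F: "laurent_emb xy ^ m * z = laurent_emb F" using add by blast
    \<comment> \<open>Large enough to make both exponents \<open>a\<close> and \<open>b\<close>
      nonnegative after adding \<open>l\<close>.\<close>
    define l where "l = nat \<bar>a\<bar> + nat \<bar>b\<bar>"
    have pw: "laurent_emb (xy ^ m) = laurent_emb xy ^ m" for m
      by (induction m) (simp_all add: emb.eval_1 emb.eval_mult)
    have "laurent_emb xy ^ l * Poly_Mapping.single k v = laurent_emb (monom (monom v (nat (int l + a))) (nat (int l + b)))"
    proof -
      have "int (nat (int l + a)) = int l + a" "int (nat (int l + b)) = int l + b"
        by (simp_all add: l_def)
      thus ?thesis unfolding k s by (simp only: laurent_emb_monom mult_single) simp
    qed
    moreover have "laurent_emb xy ^ (l + m) * (Poly_Mapping.single k v + z) =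
        laurent_emb xy ^ m * (laurent_emb xy ^ l * Poly_Mapping.single k v) + laurent_emb xy ^ l * (laurent_emb xy ^ m * z)"
      by (simp only: power_add distrib_right mult_ac)
    ultimately have "laurent_emb xy ^ (l + m) * (Poly_Mapping.single k v + z) =
        laurent_emb (xy ^ m * monom (monom v (nat (int l + a))) (nat (int l + b)) + xy ^ l * F)"
      by (simp only: F emb.eval_add emb.eval_mult pw)
    thus ?case by blast
  qed
qed

section \<open>Invertibility of x y and existence of monic elements\<close>

lemma unit_power_mem:
  assumes I: "is_ideal I" "idx I > 0" and u: "s * u - 1 \<in> I"
  shows "\<exists>k. s ^ Suc k - 1 \<in> I"
proof -
  obtain i k where ik: "s ^ i * (s ^ Suc k - 1) \<in> I" using unit_power_collision[OF I] by blast
  have "z \<in> I" if "s ^ i * z \<in> I" for z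
    using that
  proof (induction i)
    case (Suc i)
    have "s ^ i * z = u * (s ^ Suc i * z) - (s ^ i * z) * (s * u - 1)" by (simp add: algebra_simps)
    also have "\<dots> \<in> I" by (intro is_ideal_diff[OF I(1)] is_ideal_mult[OF I(1)] u Suc.prems)
    finally show ?case by (rule Suc.IH)
  qed simp
  thus ?thesis using ik by blast
qed

text \<open>If x y is a unit, some x^(k+1) - 1 lies in \<open>I\<close>, and 1 - x y u has constant
  coefficient 1. Conversely p = c + x p' gives the inverse -p'/c of x, and F = 1 + y F' the inverse
  -F' of y.\<close>

lemma xy_unit_iff:
  fixes I :: "'a::field poly poly set"
  assumes I: "is_ideal I" "idx I > 0"
  shows "(\<exists>u. xy * u - 1 \<in> I) \<longleftrightarrow> x_inv I \<and> y_inv I"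
proof
  have xy: "xy = [:[:0, 1:]:] * [:0, 1::'a poly:]" by (simp add: monom_Suc monom_0)
  {
    assume "\<exists>u. xy * u - 1 \<in> I"
    then obtain u where u: "xy * u - 1 \<in> I" by blast
    hence "[:[:0, 1:]:] * ([:0, 1:] * u) - 1 \<in> I" by (simp only: xy mult.assoc)
    then obtain k where k: "[:[:0, 1:]:] ^ Suc k - 1 \<in> I" using unit_power_mem[OF I] by blast
    have pow: "[:p:] ^ m = [:p ^ m:]" for p :: "'a poly" and m
      by (induction m) (simp_all add: one_pCons)
    have "[:[:0, 1:] ^ Suc k - 1:] \<in> I" using k unfolding pow by (simp add: one_pCons)
    moreover have "coeff ([:0, 1:] ^ Suc k - 1 :: 'a poly) 0 \<noteq> 0" by (simp add: coeff_mult)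
    ultimately have "x_inv I" unfolding x_inv_def by blast
    moreover have "1 - xy * u \<in> I" using is_ideal_diff[OF I(1) is_ideal_0[OF I(1)] u] by simp
    moreover have "coeff (1 - xy * u) 0 = 1" by (simp add: xy coeff_mult)
    ultimately show "x_inv I \<and> y_inv I" unfolding y_inv_def by blast
  }
  assume "x_inv I \<and> y_inv I"
  then obtain p F where p: "[:p:] \<in> I" "coeff p 0 \<noteq> 0" and F: "F \<in> I" "coeff F 0 = 1"
    unfolding x_inv_def y_inv_def by blast
  obtain c p' where pc: "p = pCons c p'" by (cases p)
  obtain d F' where Fd: "F = pCons d F'" by (cases F)
  define v where "v = [:smult (- inverse c) p':]"
  have "[:[:0, 1:]:] * v - 1 = [:[:- inverse c:]:] * [:p:]"
    using p(2) by (simp add: v_def pc one_pCons)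
  hence v: "[:[:0, 1:]:] * v - 1 \<in> I" using is_ideal_mult[OF I(1) p(1)] by metis
  have "[:0, 1:] * (- F') - 1 = 0 - F"
    using F(2) by (simp add: Fd poly_eq_iff[of "pCons _ _ - _"] coeff_pCons split: nat.splits)
  hence w: "[:0, 1:] * (- F') - 1 \<in> I" using is_ideal_diff[OF I(1) is_ideal_0[OF I(1)] F(1)] by metis
  have "xy * (v * (- F')) - 1 = [:0, 1:] * (- F') * ([:[:0, 1:]:] * v - 1) + ([:0, 1:] * (- F') - 1)"
    unfolding xy by (simp only: right_diff_distrib mult_1_right) (simp only: mult_ac add_diff_eq diff_add_cancel)
  also have "\<dots> \<in> I" by (intro is_ideal_add[OF I(1)] is_ideal_mult[OF I(1)] v w)
  finally show "\<exists>u. xy * u - 1 \<in> I" by blast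
qed

text \<open>There are q^(n+1) combinations of 1, y, ..., y^n with coefficients in the ground field,
  too many to be distinct modulo \<open>I\<close>. The difference of two of them has a scalar
  leading coefficient and can be made monic.\<close>

lemma monic_of_idx:
  fixes I :: "'a::{field, finite} poly poly set"
  assumes I: "is_ideal I" "idx I = CARD('a) ^ n"
  shows "\<exists>H\<in>I. H \<in> monics n"
proof -
  define S where "S = range (\<lambda>c :: 'a. [:c:])"
  define A where "A = {p \<in> deg_lt (Suc n). \<forall>i. coeff p i \<in> S}"
  have "card S = CARD('a)" unfolding S_def by (rule card_image) (simp add: inj_def)
  moreover have "0 \<in> S" by (auto simp: S_def)
  ultimately have "card A = CARD('a) ^ Suc n" 
    using card_deg_lt_coeffs[of S "Suc n"] by (simp add: A_def)
  hence "idx I < card A"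
    using I(2) CARD_field_gt_1[where 'a = 'a] by (simp add: power_strict_increasing)
  moreover have "idx I > 0" using I(2) by simp
  ultimately obtain a b where ab: "a \<in> A" "b \<in> A" "a \<noteq> b" "a - b \<in> I"
    using rindex_pigeonhole[OF is_ideal_subgrp[OF I(1)], of A UNIV] by blast
  define G where "G = a - b"
  have G0: "G \<noteq> 0" and "G \<in> deg_lt (Suc n)" and GI: "G \<in> I" using ab by (auto simp: G_def A_def deg_lt_diff)
  hence dG: "degree G \<le> n" by (simp add: deg_lt_iff)
  have "coeff a (degree G) \<in> S" "coeff b (degree G) \<in> S" using ab by (simp_all add: A_def)
  then obtain c where c: "lead_coeff G = [:c:]" by (auto simp: S_def G_def)
  hence "c \<noteq> 0" using G0 by (metis leading_coeff_0_iff pCons_0_0)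
  \<comment> \<open>Normalizes \<open>G\<close> and multiplies it by a power of y so that the degree
    is exactly \<open>n\<close>.\<close>
  define H where "H = monom [:inverse c:] (n - degree G) * G"
  have "degree (monom [:inverse c:] (n - degree G)) = n - degree G"
    using \<open>c \<noteq> 0\<close> by (simp add: degree_monom_eq)
  moreover have nz: "monom [:inverse c:] (n - degree G) \<noteq> 0" using \<open>c \<noteq> 0\<close> by simp
  ultimately have "degree H = n" using G0 dG unfolding H_def by (simp add: degree_mult_eq)
  moreover have "lead_coeff H = [:inverse c:] * [:c:]" unfolding H_def lead_coeff_mult c lead_coeff_monom ..
  hence "lead_coeff H = 1" using \<open>c \<noteq> 0\<close> by (simp add: one_pCons)
  ultimately have "H \<in> monics n" unfolding monics_iff by blast
  moreover have "H \<in> I" unfolding H_def by (rule is_ideal_mult[OF I(1) GI])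
  ultimately show ?thesis by blast
qed

lemma card_laurent_ideals:
  "card {J :: 'a::{field, finite} laurent2 set. is_ideal J \<and> idx J = CARD('a) ^ n} = card (ideals_of TYPE('a) n n)"
proof -
  have "{I :: 'a poly poly set. is_ideal I \<and> idx I = CARD('a) ^ n \<and> (\<exists>u. xy * u - 1 \<in> I)} = ideals_of TYPE('a) n n"
    using xy_unit_iff monic_of_idx unfolding ideals_of_def by (fastforce simp del: One_nat_def)
  thus ?thesis
    using bij_betw_same_card[OF laurent.bij_betw_vimage_ideals[where 'a = 'a, of "CARD('a) ^ n"]] by simp
qed


section \<open>Codimension as an index\<close>

lemma laurent2_ring_simps:
  "carrier laurent2_ring = UNIV" "monoid.mult laurent2_ring = (*)" "monoid.one laurent2_ring = 1"
  "ring.zero laurent2_ring = 0" "ring.add laurent2_ring = (+)"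
  by (simp_all add: laurent2_ring_def ring_of_type_algebra_def)

lemma ring_laurent2_ring: "ring (laurent2_ring :: 'a::field laurent2 ring)"
  unfolding laurent2_ring_def by (rule ring_from_type_algebra)

lemma ideal_laurent2_ring_iff:
  fixes J :: "'a::field laurent2 set"
  shows "ideal J laurent2_ring \<longleftrightarrow> is_ideal J"
proof
  assume J: "ideal J laurent2_ring"
  note sub = ideal.axioms(1)[OF J]
  show "is_ideal J"
    unfolding is_ideal_def
    using additive_subgroup.zero_closed[OF sub] additive_subgroup.a_closed[OF sub] ideal.I_l_closed[OF J]
    by (auto simp: laurent2_ring_simps)
next
  assume J: "is_ideal J"
  interpret ring "laurent2_ring :: 'a laurent2 ring" by (rule ring_laurent2_ring)
  have "\<ominus>\<^bsub>laurent2_ring\<^esub> a = - a" for a :: "'a laurent2"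
    by (rule minus_equality) (simp_all add: laurent2_ring_simps)
  hence "subgroup J (add_monoid laurent2_ring)"
    using is_ideal_0[OF J] is_ideal_add[OF J] is_ideal_diff[OF J is_ideal_0[OF J]]
    by (intro add.subgroupI) (auto simp: laurent2_ring_simps)
  thus "ideal J laurent2_ring"
    using is_ideal_mult[OF J] by (intro idealI ring_laurent2_ring) (auto simp: laurent2_ring_simps mult.commute)
qed

lemma a_r_coset_laurent2_ring: "J +>\<^bsub>laurent2_ring\<^esub> a = rcoset J a"
  by (force simp: a_r_coset_def' rcoset_def laurent2_ring_simps)

lemma carrier_laurent2_Quot: "carrier (laurent2_ring Quot J) = rcoset J ` UNIV"
  by (auto simp: FactRing_def A_RCOSETS_def' laurent2_ring_simps a_r_coset_laurent2_ring)

text \<open>Treats the unit ideal, where the image of the scalars is not a field and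
  \<open>card_dimension\<close> cannot be applied.\<close>

lemma (in ring) dimension_trivial_ring:
  assumes "dimension n K E" "carrier R = {\<zero>}"
  shows "n = 0 \<and> E = {\<zero>}"
  using assms by (induction rule: dimension.induct) auto

text \<open>Each extension by \<open>v\<close> multiplies the size by that of \<open>K\<close>: in k
  v + e both k and e are unique, for otherwise dividing by a nonzero difference of scalars would put
  \<open>v\<close> into \<open>E\<close>.\<close>

lemma (in ring) card_dimension:
  assumes "dimension n K E" "subfield K R" "finite K"
  shows "finite E \<and> card E = card K ^ n"
  using assms
proof (induction rule: dimension.induct)
  case (zero_dim K)
  show ?case by simp
next
  case (Suc_dim v E n K)
  note K = Suc_dim.prems
  have KR: "K \<subseteq> carrier R" "subring K R" using subfieldE(1,3)[OF K(1)] by auto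
  have "finite_dimension K E" using Suc_dim.hyps(3) by (rule finite_dimensionI)
  hence "subalgebra K E R" by (rule finite_dimension_imp_subalgebra[OF K(1)])
  hence sub: "subgroup E (add_monoid R)" and smult: "\<And>k e. k \<in> K \<Longrightarrow> e \<in> E \<Longrightarrow> k \<otimes> e \<in> E"
    unfolding subalgebra_def subalgebra_axioms_def by auto
  note E = add.subgroupE[OF sub, simplified]
  define f where "f = (\<lambda>(k, e). k \<otimes> v \<oplus> e)"
  have le: "line_extension K v E = f ` (K \<times> E)"
    by (auto simp: f_def line_extension_mem_iff) blast
  have "inj_on f (K \<times> E)"
  proof (rule inj_onI, clarify)
    fix k e k' e' assume *: "k \<in> K" "e \<in> E" "k' \<in> K" "e' \<in> E" "f (k, e) = f (k', e')"
    have car: "k \<in> carrier R" "k' \<in> carrier R" "e \<in> carrier R" "e' \<in> carrier R"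
      using * KR(1) E(1) by auto
    have eq: "k \<otimes> v \<oplus> e = k' \<otimes> v \<oplus> e'" using *(5) by (simp add: f_def)
    note car = car Suc_dim.hyps(1)
    have "(k \<ominus> k') \<otimes> v = ((k \<otimes> v \<oplus> e) \<ominus> e) \<ominus> k' \<otimes> v"
      using car by algebra
    also have "\<dots> = e' \<ominus> e" unfolding eq using car by algebra
    also have "\<dots> \<in> E" using E(3,4) * by (simp add: a_minus_def)
    finally have dv: "(k \<ominus> k') \<otimes> v \<in> E" .
    have "k \<ominus> k' \<in> K" using subringE(5,7)[OF KR(2)] * by (simp add: a_minus_def)
    have "k \<ominus> k' = \<zero>"
    proof (rule ccontr)
      assume "k \<ominus> k' \<noteq> \<zero>"
      with \<open>k \<ominus> k' \<in> K\<close> have d: "k \<ominus> k' \<in> K - {\<zero>}" by blast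
      note inv = subfield_m_inv[OF K(1) d]
      have "inv (k \<ominus> k') \<otimes> ((k \<ominus> k') \<otimes> v) \<in> E" using inv(1) dv smult by blast
      also have "inv (k \<ominus> k') \<otimes> ((k \<ominus> k') \<otimes> v) = inv (k \<ominus> k') \<otimes> (k \<ominus> k') \<otimes> v"
        using inv(1) d KR(1) car(5) by (intro m_assoc[symmetric]) auto
      also have "\<dots> = v" using inv(3) car by simp
      finally show False using Suc_dim.hyps(2) by simp
    qed
    hence "k = k'" using car by (simp add: r_right_minus_eq)
    moreover from this have "e = e'" using eq car by simp
    ultimately show "k = k' \<and> e = e'" by blast
  qed
  thus ?case using Suc_dim.IH[OF K] K(2) by (simp add: le card_image card_cartesian_product)
qed


text \<open>For proper \<open>J\<close> the image of the scalars is a field with q elements, so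
  dimension m means q^m elements. Conversely a finite quotient has some dimension, which its size
  determines.\<close>

lemma has_codim_iff_idx:
  fixes J :: "'a::{field, finite} laurent2 set"
  assumes J: "is_ideal J" and n: "n \<ge> 1"
  shows "has_codim J n \<longleftrightarrow> idx J = CARD('a) ^ n"
proof -
  define Q where "Q = laurent2_ring Quot J"
  define h where "h = (\<lambda>c :: 'a. J +>\<^bsub>laurent2_ring\<^esub> Poly_Mapping.single 0 c)"
  have I: "ideal J laurent2_ring" using J by (simp add: ideal_laurent2_ring_iff)
  interpret Q: ring Q unfolding Q_def by (rule ideal.quotient_is_ring[OF I])
  have card: "card (carrier Q) = idx J" by (simp add: Q_def carrier_laurent2_Quot rindex_def)
  have codim: "has_codim J n \<longleftrightarrow> Q.dimension n (range h) (carrier Q)"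
    by (simp add: has_codim_def Q_def h_def)
  have q: "CARD('a) ^ n > 1" using CARD_field_gt_1[where 'a = 'a] n by (intro one_less_power) simp_all
  show ?thesis
  proof (cases "carrier Q = {\<zero>\<^bsub>Q\<^esub>}")
    case True
    \<comment> \<open>The zero quotient has only the dimension 0, and its index is 1;
      \<open>n \<ge> 1\<close> rules out both sides.\<close>
    have "\<not> has_codim J n" unfolding codim using Q.dimension_trivial_ring[OF _ True] n by fastforce
    moreover have "idx J = 1" using card True by simp
    ultimately show ?thesis using q by simp
  next
    case False
    have one: "\<one>\<^bsub>Q\<^esub> \<noteq> \<zero>\<^bsub>Q\<^esub>" using False Q.carrier_one_zero by blast
    interpret F: field "ring_of_type_algebra :: 'a ring" by (rule field_from_type_algebra)
    have "(\<lambda>c. Poly_Mapping.single 0 c) \<in> ring_hom (ring_of_type_algebra :: 'a ring) laurent2_ring"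
      by (rule ring_hom_memI)
        (simp_all add: laurent2_ring_simps ring_of_type_algebra_def mult_single single_add)
    from ring_hom_trans[OF this ideal.rcos_ring_hom[OF I]]
    have "h \<in> ring_hom (ring_of_type_algebra :: 'a ring) Q"
      by (simp add: h_def Q_def o_def)
    then interpret h: ring_hom_ring "ring_of_type_algebra :: 'a ring" Q h
      by (intro ring_hom_ringI2 F.ring_axioms Q.ring_axioms)
    have UNIV: "carrier (ring_of_type_algebra :: 'a ring) = UNIV" by (simp add: ring_of_type_algebra_def)
    have "inj h" and K: "subfield (range h) Q"
      using h.img_is_subfield[OF F.carrier_is_subfield one] by (simp_all add: UNIV)
    hence cK: "card (range h) = CARD('a)" by (simp add: card_image)
    have dim: "card (carrier Q) = CARD('a) ^ m" if "Q.dimension m (range h) (carrier Q)" for m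
      using Q.card_dimension[OF that K] cK by simp
    show ?thesis
    proof
      assume "has_codim J n" thus "idx J = CARD('a) ^ n" using dim card by (simp add: codim)
    next
      assume idx: "idx J = CARD('a) ^ n"
      hence "finite (carrier Q)" using card by (intro card_ge_0_finite) simp
      \<comment> \<open>The list of all elements spans the finite quotient, which is therefore
        finite-dimensional.\<close>
      then obtain Us where Us: "set Us = carrier Q" using finite_list by blast
      have "Q.Span (range h) Us = carrier Q"
        using Q.Span_base_incl[OF K, of Us] Q.Span_in_carrier[OF subfieldE(3)[OF K], of Us] Us by blast
      moreover have "Q.finite_dimension (range h) (Q.Span (range h) Us)"
        using Q.Span_finite_dimension[OF K] Us by blast
      ultimately obtain m where m: "Q.dimension m (range h) (carrier Q)"
        unfolding Q.finite_dimension_def by auto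
      hence "CARD('a) ^ m = CARD('a) ^ n" using dim card idx by simp
      hence "m = n" using CARD_field_gt_1[where 'a = 'a] by simp
      thus "has_codim J n" using m by (simp add: codim)
    qed
  qed
qed

lemma ideal_count_eq:
  assumes "n \<ge> 1"
  shows "ideal_count TYPE('a::{field, finite}) n = card {J :: 'a laurent2 set. is_ideal J \<and> idx J = CARD('a) ^ n}"
  unfolding ideal_count_def using assms by (simp add: ideal_laurent2_ring_iff has_codim_iff_idx cong: conj_cong)


section \<open>Sums over partitions\<close>

text \<open>The bound on the parts is the counterpart of \<open>t\<close> in
  \<open>ideals_of\<close>, so that both satisfy the same recursion.\<close>

definition bounded_partitions :: "nat \<Rightarrow> nat \<Rightarrow> nat multiset set"
  where "bounded_partitions t n = {\<mu> \<in> partitions_of n. \<forall>p\<in>#\<mu>. p \<le> t}"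

lemma partition_part_le: "\<mu> \<in> partitions_of n \<Longrightarrow> p \<in># \<mu> \<Longrightarrow> 1 \<le> p \<and> p \<le> n"
proof -
  assume \<mu>: "\<mu> \<in> partitions_of n" and p: "p \<in># \<mu>"
  obtain \<nu> where "\<mu> = add_mset p \<nu>" using multi_member_split[OF p] by blast
  thus "1 \<le> p \<and> p \<le> n" using \<mu> by (auto simp: partitions_of_def Suc_le_eq)
qed

lemma bounded_partitions_self: "bounded_partitions n n = partitions_of n"
  using partition_part_le by (auto simp: bounded_partitions_def)

lemma bounded_partitions_0: "bounded_partitions 0 n = (if n = 0 then {{#}} else {})"
proof -
  have "\<mu> \<in> bounded_partitions 0 n \<longleftrightarrow> \<mu> = {#} \<and> n = 0" for \<mu>
  proof (cases "\<mu> = {#}")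
    case False
    then obtain p where "p \<in># \<mu>" by blast
    thus ?thesis using False partition_part_le[of \<mu> n p]
      by (auto simp: bounded_partitions_def intro!: bexI[of _ p])
  qed (auto simp: bounded_partitions_def partitions_of_def)
  thus ?thesis by auto
qed

text \<open>Removing all copies of the part \<open>t + 1\<close> inverts the map; \<open>e\<close>
  is their multiplicity, matching the degree of \<open>g\<close> in
  \<open>ideals_of_Suc\<close>.\<close>

lemma bounded_partitions_Suc:
  "bij_betw (\<lambda>(e, \<mu>). \<mu> + replicate_mset e (Suc t))
    (SIGMA e:{e. Suc t * e \<le> n}. bounded_partitions t (n - Suc t * e)) (bounded_partitions (Suc t) n)"
proof (rule bij_betw_byWitness[where f' = "\<lambda>\<mu>. (count \<mu> (Suc t), filter_mset (\<lambda>p. p \<noteq> Suc t) \<mu>)"])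
  have [simp]: "sum_mset (replicate_mset e k) = k * e" for e k :: nat by (induction e) simp_all
  let ?D = "SIGMA e:{e. Suc t * e \<le> n}. bounded_partitions t (n - Suc t * e)"
  have split: "filter_mset (\<lambda>p. p \<noteq> Suc t) \<mu> + replicate_mset (count \<mu> (Suc t)) (Suc t) = \<mu>" for \<mu>
    by (rule multiset_eqI) simp
  show "\<forall>x\<in>?D. (\<lambda>\<mu>. (count \<mu> (Suc t), filter_mset (\<lambda>p. p \<noteq> Suc t) \<mu>)) ((\<lambda>(e, \<mu>). \<mu> + replicate_mset e (Suc t)) x) = x"
  proof
    fix x assume "x \<in> ?D"
    then obtain e \<mu> where x: "x = (e, \<mu>)" and "\<mu> \<in> bounded_partitions t (n - Suc t * e)" by blast
    hence "\<forall>p\<in>#\<mu>. p \<noteq> Suc t" by (auto simp: bounded_partitions_def)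
    moreover from this have "count \<mu> (Suc t) = 0" by (metis count_eq_zero_iff)
    ultimately show "(\<lambda>\<mu>. (count \<mu> (Suc t), filter_mset (\<lambda>p. p \<noteq> Suc t) \<mu>)) ((\<lambda>(e, \<mu>). \<mu> + replicate_mset e (Suc t)) x) = x"
      by (auto simp: x multiset_eq_iff)
  qed
  show "\<forall>\<mu>\<in>bounded_partitions (Suc t) n. (\<lambda>(e, \<mu>). \<mu> + replicate_mset e (Suc t)) (count \<mu> (Suc t), filter_mset (\<lambda>p. p \<noteq> Suc t) \<mu>) = \<mu>"
    by (simp add: split)
  show "(\<lambda>(e, \<mu>). \<mu> + replicate_mset e (Suc t)) ` ?D \<subseteq> bounded_partitions (Suc t) n"
    by (auto simp: bounded_partitions_def partitions_of_def le_Suc_eq split: if_splits)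
  show "(\<lambda>\<mu>. (count \<mu> (Suc t), filter_mset (\<lambda>p. p \<noteq> Suc t) \<mu>)) ` bounded_partitions (Suc t) n \<subseteq> ?D"
  proof (rule image_subsetI)
    fix \<mu> assume \<mu>: "\<mu> \<in> bounded_partitions (Suc t) n"
    have "n = sum_mset (filter_mset (\<lambda>p. p \<noteq> Suc t) \<mu> + replicate_mset (count \<mu> (Suc t)) (Suc t))"
      using \<mu> unfolding split by (simp add: bounded_partitions_def partitions_of_def)
    hence "n = sum_mset (filter_mset (\<lambda>p. p \<noteq> Suc t) \<mu>) + Suc t * count \<mu> (Suc t)" by simp
    thus "(count \<mu> (Suc t), filter_mset (\<lambda>p. p \<noteq> Suc t) \<mu>) \<in> ?D"
      using \<mu> by (auto simp: bounded_partitions_def partitions_of_def le_Suc_eq)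
  qed
qed

lemma finite_bounded_partitions: "finite (bounded_partitions t n)"
proof (induction t arbitrary: n)
  case 0
  show ?case by (simp add: bounded_partitions_0)
next
  case (Suc t)
  show ?case
    unfolding bij_betw_finite[OF bounded_partitions_Suc, symmetric]
    by (intro finite_SigmaI finite_multiples_le Suc)
qed

lemma finite_partitions_of: "finite (partitions_of n)"
  using finite_bounded_partitions[of n n] by (simp add: bounded_partitions_self)

text \<open>Induction on \<open>t\<close> with the parallel recursions. The part
  \<open>t + 1\<close> of multiplicity \<open>e\<close> contributes q^(t e), whence the exponent
  with \<open>p - 1\<close>; values \<open>p\<close> that do not occur contribute 1.\<close>

lemma card_ideals_of:
  "card (ideals_of TYPE('a::{field, finite}) t n) =
    (\<Sum>\<mu>\<in>bounded_partitions t n. \<Prod>p\<in>{1..t}. CARD('a) ^ ((p - 1) * count \<mu> p) * coprime_count TYPE('a) (count \<mu> p))"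
proof (induction t arbitrary: n)
  case 0
  show ?case by (simp add: ideals_of_0 bounded_partitions_0)
next
  case (Suc t)
  define w where "w t \<mu> = (\<Prod>p\<in>{1..t}. CARD('a) ^ ((p - 1) * count \<mu> p) * coprime_count TYPE('a) (count \<mu> p))" for t \<mu>
  have w: "w (Suc t) (\<mu> + replicate_mset e (Suc t)) = CARD('a) ^ (e * t) * coprime_count TYPE('a) e * w t \<mu>"
    if "\<mu> \<in> bounded_partitions t m" for \<mu> e m
  proof -
    have "\<forall>p\<in>#\<mu>. p \<noteq> Suc t" using that by (auto simp: bounded_partitions_def)
    hence "count \<mu> (Suc t) = 0" by (metis count_eq_zero_iff)
    moreover have "w t (\<mu> + replicate_mset e (Suc t)) = w t \<mu>"
      unfolding w_def by (intro prod.cong) auto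
    moreover have "w (Suc t) \<nu> = w t \<nu> * (CARD('a) ^ (t * count \<nu> (Suc t)) * coprime_count TYPE('a) (count \<nu> (Suc t)))" for \<nu>
      unfolding w_def by (subst prod.cl_ivl_Suc) simp
    ultimately show ?thesis by (simp add: mult_ac)
  qed
  have "(\<Sum>\<mu>\<in>bounded_partitions (Suc t) n. w (Suc t) \<mu>) =
      (\<Sum>(e, \<mu>)\<in>(SIGMA e:{e. Suc t * e \<le> n}. bounded_partitions t (n - Suc t * e)). w (Suc t) (\<mu> + replicate_mset e (Suc t)))"
    using sum.reindex_bij_betw[OF bounded_partitions_Suc, of "w (Suc t)" t n] by (simp add: case_prod_unfold)
  also have "\<dots> = (\<Sum>e | Suc t * e \<le> n. \<Sum>\<mu>\<in>bounded_partitions t (n - Suc t * e). w (Suc t) (\<mu> + replicate_mset e (Suc t)))"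
    by (subst sum.Sigma) (auto simp: finite_bounded_partitions intro: finite_multiples_le[of t n, simplified])
  also have "\<dots> = (\<Sum>e | Suc t * e \<le> n. CARD('a) ^ (e * t) * coprime_count TYPE('a) e * card (ideals_of TYPE('a) t (n - Suc t * e)))"
    unfolding Suc.IH sum_distrib_left w_def[symmetric] by (intro sum.cong refl w)
  also have "\<dots> = card (ideals_of TYPE('a) (Suc t) n)"
    by (rule card_ideals_of_Suc(2)[OF finite_ideals_of, symmetric])
  finally show ?case by (simp add: w_def)
qed

section \<open>Columns of the diagram and multiplicities of parts\<close>

lemma sum_mset_eq_sum_count: "sum_mset \<mu> = (\<Sum>p\<in>set_mset \<mu>. p * count \<mu> p)" for \<mu> :: "nat multiset"
proof (induction \<mu>)
  case (add x \<mu>)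
  have "(\<Sum>p\<in>set_mset (add_mset x \<mu>). p * count (add_mset x \<mu>) p) =
      (\<Sum>p\<in>insert x (set_mset \<mu>). p * count \<mu> p + (if p = x then p else 0))"
    by (intro sum.cong) auto
  also have "\<dots> = (\<Sum>p\<in>insert x (set_mset \<mu>). p * count \<mu> p) + x"
    by (simp add: sum.distrib)
  also have "(\<Sum>p\<in>insert x (set_mset \<mu>). p * count \<mu> p) = (\<Sum>p\<in>set_mset \<mu>. p * count \<mu> p)"
    by (rule sum.mono_neutral_right) (auto simp: not_in_iff)
  finally show ?case using add by simp
qed simp

text \<open>Turns the global exponent \<open>n - size \<mu>\<close> of q into a sum over the
  distinct parts.\<close>

lemma partition_defect:
  assumes "\<mu> \<in> partitions_of n"
  shows "(\<Sum>p\<in>set_mset \<mu>. (p - 1) * count \<mu> p) + size \<mu> = n"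
proof -
  have "(\<Sum>p\<in>set_mset \<mu>. (p - 1) * count \<mu> p) + size \<mu> = (\<Sum>p\<in>set_mset \<mu>. (p - 1) * count \<mu> p + count \<mu> p)"
    by (simp add: size_multiset_overloaded_eq sum.distrib)
  also have "\<dots> = (\<Sum>p\<in>set_mset \<mu>. p * count \<mu> p)"
  proof (rule sum.cong)
    fix p assume "p \<in> set_mset \<mu>"
    hence "p = Suc (p - 1)" using partition_part_le[OF assms] by fastforce
    thus "(p - 1) * count \<mu> p + count \<mu> p = p * count \<mu> p" by (metis add.commute mult_Suc)
  qed simp
  also have "\<dots> = n" using assms by (simp add: partitions_of_def sum_mset_eq_sum_count)
  finally show ?thesis .
qed

text \<open>Adjacent columns are given by the adjacent thresholds \<open>a\<close> and
  \<open>a + 1\<close>, so their lengths differ by the number of parts equal to \<open>a\<close>.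
  The bounds on \<open>i\<close> keep the subtractions from truncating.\<close>

lemma col_diff_eq_count:
  assumes "1 \<le> i" "i \<le> num_cols \<mu>"
  shows "col_diff \<mu> i = count \<mu> (num_cols \<mu> + 1 - i)"
proof -
  define a where "a = num_cols \<mu> + 1 - i"
  have i: "num_cols \<mu> - i + 1 = a" "num_cols \<mu> - (i - 1) + 1 = Suc a" using assms by (auto simp: a_def)
  have "filter_mset (\<lambda>p. p \<ge> a) \<mu> = filter_mset (\<lambda>p. p \<ge> Suc a) \<mu> + replicate_mset (count \<mu> a) a"
    by (rule multiset_eqI) auto
  hence "size (filter_mset (\<lambda>p. p \<ge> a) \<mu>) = size (filter_mset (\<lambda>p. p \<ge> Suc a) \<mu>) + count \<mu> a"
    by simp
  thus ?thesis unfolding col_diff_def col_len_def i by (simp add: a_def)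
qed

lemma bij_betw_jumps:
  assumes "\<mu> \<in> partitions_of n"
  shows "bij_betw (\<lambda>i. num_cols \<mu> + 1 - i) (jumps \<mu>) (set_mset \<mu>)"
proof (rule bij_betw_byWitness[where f' = "\<lambda>p. num_cols \<mu> + 1 - p"])
  have part: "1 \<le> p" "p \<le> num_cols \<mu>" if "p \<in># \<mu>" for p
    using that partition_part_le[OF assms] by (auto simp: num_cols_def)
  show "\<forall>i\<in>jumps \<mu>. num_cols \<mu> + 1 - (num_cols \<mu> + 1 - i) = i" by (auto simp: jumps_def)
  show "\<forall>p\<in>#\<mu>. num_cols \<mu> + 1 - (num_cols \<mu> + 1 - p) = p" using part(2) by fastforce
  show "(\<lambda>i. num_cols \<mu> + 1 - i) ` jumps \<mu> \<subseteq> set_mset \<mu>"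
    by (auto simp: jumps_def col_diff_eq_count Suc_le_eq)
  show "(\<lambda>p. num_cols \<mu> + 1 - p) ` set_mset \<mu> \<subseteq> jumps \<mu>"
  proof (rule image_subsetI)
    fix p assume p: "p \<in># \<mu>"
    have i: "1 \<le> num_cols \<mu> + 1 - p" "num_cols \<mu> + 1 - p \<le> num_cols \<mu>" using part[OF p] by auto
    moreover have "num_cols \<mu> + 1 - (num_cols \<mu> + 1 - p) = p" using part[OF p] by simp
    ultimately show "num_cols \<mu> + 1 - p \<in> jumps \<mu>"
      using p col_diff_eq_count[OF i] by (simp add: jumps_def Suc_le_eq)
  qed
qed

text \<open>Reindexes the jumps by the distinct parts via \<open>bij_betw_jumps\<close> and gives
  each part one factor (q - 1)^2 and its share of the power of q.\<close>

lemma C_expr_eq_sum_prod: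
  "C_expr n q = (\<Sum>\<mu>\<in>partitions_of n. \<Prod>p\<in>set_mset \<mu>.
    q ^ ((p - 1) * count \<mu> p) * ((q - 1)\<^sup>2 * ((q ^ (2 * count \<mu> p) - 1) / (q\<^sup>2 - 1))))"
  unfolding C_expr_def
proof (rule sum.cong)
  fix \<mu> assume \<mu>: "\<mu> \<in> partitions_of n"
  note bij = bij_betw_jumps[OF \<mu>]
  have "n - size \<mu> = (\<Sum>p\<in>set_mset \<mu>. (p - 1) * count \<mu> p)" using partition_defect[OF \<mu>] by simp
  hence "q ^ (n - size \<mu>) = (\<Prod>p\<in>set_mset \<mu>. q ^ ((p - 1) * count \<mu> p))" by (simp add: power_sum)
  moreover have "(q - 1) ^ (2 * num_jumps \<mu>) = (\<Prod>p\<in>set_mset \<mu>. (q - 1)\<^sup>2)"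
    using bij_betw_same_card[OF bij] by (simp add: num_jumps_def power_mult)
  moreover have "(\<Prod>i\<in>jumps \<mu>. (q ^ (2 * col_diff \<mu> i) - 1) / (q\<^sup>2 - 1)) =
      (\<Prod>p\<in>set_mset \<mu>. (q ^ (2 * count \<mu> p) - 1) / (q\<^sup>2 - 1))"
    unfolding prod.reindex_bij_betw[OF bij, symmetric]
    by (intro prod.cong) (auto simp: jumps_def col_diff_eq_count)
  ultimately show "(q - 1) ^ (2 * num_jumps \<mu>) * q ^ (n - size \<mu>) *
      (\<Prod>i\<in>jumps \<mu>. (q ^ (2 * col_diff \<mu> i) - 1) / (q\<^sup>2 - 1)) =
      (\<Prod>p\<in>set_mset \<mu>. q ^ ((p - 1) * count \<mu> p) * ((q - 1)\<^sup>2 * ((q ^ (2 * count \<mu> p) - 1) / (q\<^sup>2 - 1))))"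
    by (simp only: prod.distrib mult_ac)
qed simp

section \<open>The counting polynomial\<close>

text \<open>The quotient (q^(2c) - 1) / (q^2 - 1) written as a geometric sum, which makes the
  coefficients integral. At \<open>c = 0\<close> it is 0 while \<open>coprime_count\<close> is 1, so
  products of it run over \<open>set_mset\<close> only.\<close>

definition coprime_poly :: "nat \<Rightarrow> int poly"
  where "coprime_poly c = [:- 1, 1:]\<^sup>2 * (\<Sum>j<c. monom 1 (2 * j))"

definition C_poly :: "nat \<Rightarrow> int poly"
  where "C_poly n = (\<Sum>\<mu>\<in>partitions_of n. \<Prod>p\<in>set_mset \<mu>. monom 1 ((p - 1) * count \<mu> p) * coprime_poly (count \<mu> p))"

lemma poly_coprime_poly:
  assumes "x\<^sup>2 \<noteq> 1"
  shows "(of_int (poly (coprime_poly c) x) :: rat) =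
    (of_int x - 1)\<^sup>2 * ((of_int x ^ (2 * c) - 1) / ((of_int x)\<^sup>2 - 1))"
proof -
  define y where "y = (of_int x :: rat)"
  have "of_int (x\<^sup>2) \<noteq> (of_int 1 :: rat)" using assms by (simp only: of_int_eq_iff not_False_eq_True)
  hence "y\<^sup>2 - 1 \<noteq> 0" by (simp add: y_def)
  hence "(\<Sum>j<c. (y\<^sup>2) ^ j) = ((y\<^sup>2) ^ c - 1) / (y\<^sup>2 - 1)"
    by (simp add: power_diff_1_eq)
  thus ?thesis
    by (simp add: coprime_poly_def poly_sum poly_monom y_def power_mult)
qed

lemma poly_C_poly:
  assumes "x\<^sup>2 \<noteq> 1"
  shows "(of_int (poly (C_poly n) x) :: rat) = C_expr n (of_int x)"
  unfolding C_expr_eq_sum_prod C_poly_def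
  by (simp add: poly_sum poly_prod poly_monom poly_coprime_poly[OF assms])

lemma monics_mult:
  fixes F G :: "'a::idom poly"
  assumes "F \<in> monics a" "G \<in> monics b"
  shows "F * G \<in> monics (a + b)"
proof -
  have F: "degree F = a" "lead_coeff F = 1" and G: "degree G = b" "lead_coeff G = 1"
    using assms unfolding monics_iff by blast+
  have "F \<noteq> 0" "G \<noteq> 0" using F(2) G(2) by auto
  hence "degree (F * G) = a + b" using F(1) G(1) by (simp add: degree_mult_eq)
  moreover have "lead_coeff (F * G) = 1" unfolding lead_coeff_mult F(2) G(2) by simp
  ultimately show ?thesis unfolding monics_iff by blast
qed

lemma monics_1: "1 \<in> monics 0"
  by (simp add: monics_iff)

lemma monics_prod:
  fixes f :: "'b \<Rightarrow> 'a::idom poly"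
  assumes "finite A" "\<And>x. x \<in> A \<Longrightarrow> f x \<in> monics (d x)"
  shows "prod f A \<in> monics (sum d A)"
  using assms by (induction A rule: finite_induct) (simp_all add: monics_1 monics_mult)

lemma monom_monics: "monom 1 k \<in> monics k"
  by (auto simp: monics_def deg_lt_def)

lemma coprime_poly_monics: "coprime_poly (Suc c) \<in> monics (2 * Suc c)"
proof -
  have "(\<Sum>j<Suc c. monom 1 (2 * j)) \<in> (monics (2 * c) :: int poly set)"
  proof (induction c)
    case (Suc c)
    hence "(\<Sum>j<Suc c. monom 1 (2 * j)) \<in> (deg_lt (Suc (2 * c)) :: int poly set)" by (simp add: monics_def)
    hence "(\<Sum>j<Suc c. monom 1 (2 * j)) \<in> (deg_lt (2 * Suc c) :: int poly set)"
      using deg_lt_mono[of "Suc (2 * c)" "2 * Suc c"] by auto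
    from monics_add[OF monom_monics this] show ?case by (simp add: add.commute)
  qed (simp add: monics_1)
  moreover have "[:- 1, 1:] \<in> (monics 1 :: int poly set)" by (simp add: monics_iff)
  hence "[:- 1, 1:]\<^sup>2 \<in> (monics 2 :: int poly set)"
    using monics_mult[of "[:- 1, 1:]" 1 "[:- 1, 1:]" 1] by (simp only: power2_eq_square one_add_one)
  ultimately show ?thesis using monics_mult by (fastforce simp: coprime_poly_def)
qed

text \<open>A part p of multiplicity c has degree (p - 1) c + 2 c. By
  \<open>partition_defect\<close> the first summands add up to \<open>n - size \<mu>\<close>, the
  second to twice \<open>size \<mu>\<close>.\<close>

lemma C_poly_term_monics:
  assumes "\<mu> \<in> partitions_of n"
  shows "(\<Prod>p\<in>set_mset \<mu>. monom 1 ((p - 1) * count \<mu> p) * coprime_poly (count \<mu> p)) \<in> monics (n + size \<mu>)"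
proof -
  have "(\<Prod>p\<in>set_mset \<mu>. monom 1 ((p - 1) * count \<mu> p) * coprime_poly (count \<mu> p))
      \<in> monics (\<Sum>p\<in>set_mset \<mu>. (p - 1) * count \<mu> p + 2 * count \<mu> p)"
  proof (rule monics_prod)
    fix p assume "p \<in># \<mu>"
    then obtain c where "count \<mu> p = Suc c" by (metis count_eq_zero_iff not0_implies_Suc)
    thus "monom 1 ((p - 1) * count \<mu> p) * coprime_poly (count \<mu> p) \<in> monics ((p - 1) * count \<mu> p + 2 * count \<mu> p)"
      by (simp only: monics_mult monom_monics coprime_poly_monics)
  qed simp
  also have "(\<Sum>p\<in>set_mset \<mu>. (p - 1) * count \<mu> p + 2 * count \<mu> p) =
      ((\<Sum>p\<in>set_mset \<mu>. (p - 1) * count \<mu> p) + size \<mu>) + size \<mu>"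
    by (simp add: sum.distrib size_multiset_overloaded_eq sum_distrib_left[symmetric])
  finally show ?thesis by (simp only: partition_defect[OF assms])
qed

text \<open>A term has degree \<open>n + size \<mu>\<close>, and only the partition
  \<open>\<nu>\<close> into ones has \<open>n\<close> parts; its monic term of degree
  \<open>2 * n\<close> dominates all others.\<close>

lemma C_poly_monics: "C_poly n \<in> monics (2 * n)"
proof -
  define \<nu> where "\<nu> = replicate_mset n (1 :: nat)"
  define f where "f \<mu> = (\<Prod>p\<in>set_mset \<mu>. monom 1 ((p - 1) * count \<mu> p) * coprime_poly (count \<mu> p))" for \<mu>
  have \<nu>: "\<nu> \<in> partitions_of n" "size \<nu> = n"
    unfolding \<nu>_def partitions_of_def by (induction n) auto
  have "size \<mu> < n" if "\<mu> \<in> partitions_of n" "\<mu> \<noteq> \<nu>" for \<mu>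
  proof -
    have "size \<mu> \<le> n" using partition_defect[OF that(1)] by simp
    moreover have "size \<mu> \<noteq> n"
    proof
      assume "size \<mu> = n"
      hence "(\<Sum>p\<in>set_mset \<mu>. (p - 1) * count \<mu> p) = 0" using partition_defect[OF that(1)] by simp
      hence zero: "\<forall>p\<in>#\<mu>. (p - 1) * count \<mu> p = 0" by (subst (asm) sum_eq_0_iff) simp_all
      hence one: "p = 1" if "p \<in># \<mu>" for p
      proof -
        have "count \<mu> p \<noteq> 0" using that by simp
        moreover have "(p - 1) * count \<mu> p = 0" using \<open>\<forall>p\<in>#\<mu>. _ p = 0\<close> that by blast
        ultimately have "p \<le> 1" by (metis mult_is_0 diff_is_0_eq)
        thus ?thesis using partition_part_le[OF \<open>\<mu> \<in> partitions_of n\<close> that] by simp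
      qed
      hence "set_mset \<mu> \<subseteq> {1}" by blast
      hence "\<mu> = \<nu>" using \<open>size \<mu> = n\<close> by (metis \<nu>_def set_mset_subset_singletonD)
      thus False using that(2) by simp
    qed
    ultimately show ?thesis by simp
  qed
  hence "f \<mu> \<in> deg_lt (2 * n)" if "\<mu> \<in> partitions_of n - {\<nu>}" for \<mu>
    using C_poly_term_monics[of \<mu> n] deg_lt_mono[of "Suc (n + size \<mu>)" "2 * n"] that
    by (force simp: f_def monics_def)
  hence "sum f (partitions_of n - {\<nu>}) \<in> deg_lt (2 * n)"
    by (induction "partitions_of n - {\<nu>}" rule: infinite_finite_induct) (auto simp: deg_lt_def coeff_sum)
  moreover have "f \<nu> \<in> monics (2 * n)"
    using C_poly_term_monics[OF \<nu>(1)] \<nu>(2) by (simp add: f_def mult_2)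
  ultimately have "f \<nu> + sum f (partitions_of n - {\<nu>}) \<in> monics (2 * n)" by (intro monics_add)
  thus ?thesis
    using sum.remove[OF finite_partitions_of \<nu>(1), of f] by (simp add: C_poly_def f_def)
qed

lemma square_dvd_C_poly:
  assumes "n \<ge> 1"
  shows "[:- 1, 1:]\<^sup>2 dvd C_poly n"
  unfolding C_poly_def
proof (rule dvd_sum)
  fix \<mu> assume \<mu>: "\<mu> \<in> partitions_of n"
  have "\<mu> \<noteq> {#}" using \<mu> assms by (auto simp: partitions_of_def)
  then obtain p where p: "p \<in># \<mu>" by blast
  have "[:- 1, 1:]\<^sup>2 dvd monom 1 ((p - 1) * count \<mu> p) * coprime_poly (count \<mu> p)"
    unfolding coprime_poly_def by (rule dvd_mult, rule dvd_triv_left)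
  also have "\<dots> dvd (\<Prod>p\<in>set_mset \<mu>. monom 1 ((p - 1) * count \<mu> p) * coprime_poly (count \<mu> p))"
    using p by (intro dvd_prodI) auto
  finally show "[:- 1, 1:]\<^sup>2 dvd (\<Prod>p\<in>set_mset \<mu>. monom 1 ((p - 1) * count \<mu> p) * coprime_poly (count \<mu> p))" .
qed

lemma card_ideals_of_eq_poly:
  "int (card (ideals_of TYPE('a::{field, finite}) n n)) = poly (C_poly n) (int CARD('a))"
proof -
  have cop: "int (coprime_count TYPE('a) c) = poly (coprime_poly c) (int CARD('a))" if c: "c > 0" for c
  proof -
    obtain e where "c = Suc e" using c gr0_implies_Suc by blast
    thus ?thesis by (simp add: coprime_count_Suc coprime_poly_def poly_sum poly_monom lessThan_Suc_atMost)
  qed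
  have "int (card (ideals_of TYPE('a) n n)) = (\<Sum>\<mu>\<in>partitions_of n. \<Prod>p\<in>{1..n}.
      int CARD('a) ^ ((p - 1) * count \<mu> p) * int (coprime_count TYPE('a) (count \<mu> p)))"
    by (simp add: card_ideals_of bounded_partitions_self)
  also have "\<dots> = (\<Sum>\<mu>\<in>partitions_of n. \<Prod>p\<in>set_mset \<mu>.
      int CARD('a) ^ ((p - 1) * count \<mu> p) * int (coprime_count TYPE('a) (count \<mu> p)))"
  \<comment> \<open>Numbers that are not parts have multiplicity 0 and contribute the factor 1, by
    \<open>coprime_count_0\<close>.\<close>
  proof (intro sum.cong refl prod.mono_neutral_right)
    fix \<mu> assume \<mu>: "\<mu> \<in> partitions_of n"
    show "set_mset \<mu> \<subseteq> {1..n}" using partition_part_le[OF \<mu>] by auto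
  qed (auto simp: not_in_iff coprime_count_0)
  also have "\<dots> = poly (C_poly n) (int CARD('a))"
    unfolding C_poly_def poly_sum poly_prod
    by (intro sum.cong prod.cong refl) (simp add: poly_monom cop)
  finally show ?thesis .
qed


theorem theorem1p1:
  fixes n :: nat
  assumes "n \<ge> 1"
  shows "of_nat (ideal_count TYPE('a::{field, finite}) n) = C_expr n (of_nat CARD('a)) \<and>
    (\<exists>P :: int poly.
      (\<forall>q :: nat. primepow q \<longrightarrow> of_int (poly P (int q)) = C_expr n (of_nat q)) \<and>
      int (ideal_count TYPE('a) n) = poly P (int CARD('a)) \<and>
      Polynomial.degree P = 2 * n \<and> Polynomial.lead_coeff P = 1 \<and>
      [:-1, 1:] ^ 2 dvd P)"
proof -
  \<comment> \<open>Valid for every \<open>q > 1\<close>, where q^2 - 1 is nonzero; hence one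
    polynomial serves all prime powers and not just the size of the given field.\<close>
  have C: "of_int (poly (C_poly n) (int q)) = C_expr n (of_nat q)" if "q > 1" for q
  proof -
    have "1 < (int q)\<^sup>2" using that by (intro one_less_power) simp_all
    thus ?thesis using poly_C_poly[of "int q" n] by simp
  qed
  have count: "int (ideal_count TYPE('a) n) = poly (C_poly n) (int CARD('a))"
    unfolding ideal_count_eq[OF assms] card_laurent_ideals by (rule card_ideals_of_eq_poly)
  have "rat_of_nat (ideal_count TYPE('a) n) = of_int (int (ideal_count TYPE('a) n))" by simp
  also have "\<dots> = C_expr n (of_nat CARD('a))" unfolding count by (rule C[OF CARD_field_gt_1])
  finally have "of_nat (ideal_count TYPE('a) n) = C_expr n (of_nat CARD('a))" .
  moreover have "degree (C_poly n) = 2 * n \<and> lead_coeff (C_poly n) = 1"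
    using C_poly_monics[of n] unfolding monics_iff .
  ultimately show ?thesis
    using C primepow_gt_Suc_0 count square_dvd_C_poly[OF assms] by (intro conjI exI[of _ "C_poly n"]) auto
qed

end
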